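(* Fix $\gamma>0$. There exist positive constants $c,C$ such that for every integer $n\ge0$ and every $x>0$, $$\mathbb{P}\left(L_{1,1}^{(n)}\le\mu_ne^{-x}\right)\ge ce^{-Cx^2}\qquad\text{and}\qquad\mathbb{P}\left(L_{1,1}^{(n)}\ge\mu_ne^{x}\right)\ge ce^{-Cx^2}.$$
   Context: Let $k:\mathbb{R}^2\to[0,\infty)$ be a smooth, radially symmetric, nonnegative bump function supported in $B(0,r_0)\subset\mathbb{R}^2$ with $\int_{\mathbb{R}^2}k^2\,dx=1$, where $r_0>0$ is a fixed small real number (below a suitable absolute constant). Let $\xi(dy,dt)$ be a white noise on $\mathbb{R}^2\times[0,\infty)$. For $n\ge 0$ define the smooth centered Gaussian field on $\mathbb{R}^2$ $$\phi_{0,n}(x)=\int_{\mathbb{R}^2}\int_{2^{-n-1}}^{1}k\left(\frac{y-x}{t}\right)t^{-3/2}\,\xi(dy,dt).$$ $L_{1,1}^{(n)}$ is the left-right length of $[0,1]^2$ for the Riemannian metric $e^{\gamma\phi_{0,n}}ds^2$ restricted to $[0,1]^2$: the infimum of $\int_0^1 e^{\frac{\gamma}{2}\phi_{0,n}(\pi(t))}|\pi'(t)|\,dt$ over piecewise $C^1$ paths $\pi:[0,1]\to[0,1]^2$ joining $\{0\}\times[0,1]$ to $\{1\}\times[0,1]$. $\mu_n$ is the median of $L_{1,1}^{(n)}$. The constants may depend on $k,\gamma$ but not on $n,x$. *)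

theory Defs
  imports "HOL-Probability.Probability"
begin

type_synonym plane = "real ^ 2"

primrec C_k :: "nat \<Rightarrow> ('a::euclidean_space \<Rightarrow> real) \<Rightarrow> bool" where
  "C_k 0 f \<longleftrightarrow> continuous_on UNIV f"
| "C_k (Suc m) f \<longleftrightarrow> (\<forall>x. f differentiable (at x)) \<and>
     (\<forall>b\<in>Basis. C_k m (\<lambda>x. frechet_derivative f (at x) b))"

definition smooth :: "('a::euclidean_space \<Rightarrow> real) \<Rightarrow> bool" where
  "smooth f \<longleftrightarrow> (\<forall>m. C_k m f)"

definition bump_function :: "real \<Rightarrow> (plane \<Rightarrow> real) \<Rightarrow> bool" where
  "bump_function r\<^sub>0 k \<longleftrightarrow>
     smooth k \<and>
     (\<forall>x y. norm x = norm y \<longrightarrow> k x = k y) \<and>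
     (\<forall>x. 0 \<le> k x) \<and>
     closure {x. k x \<noteq> 0} \<subseteq> ball 0 r\<^sub>0 \<and>
     (\<integral>x. (k x)\<^sup>2 \<partial>lborel) = 1"

text \<open>The zero random variable is a (degenerate) centered Gaussian.\<close>

definition centered_gaussian :: "'w measure \<Rightarrow> ('w \<Rightarrow> real) \<Rightarrow> bool" where
  "centered_gaussian M X \<longleftrightarrow>
     X \<in> borel_measurable M \<and>
     ((AE \<omega> in M. X \<omega> = 0) \<or> (\<exists>\<sigma>>0. distributed M lborel X (normal_density 0 \<sigma>)))"

definition centered_gaussian_process ::
    "'w measure \<Rightarrow> 'i set \<Rightarrow> ('i \<Rightarrow> 'w \<Rightarrow> real) \<Rightarrow> bool" where
  "centered_gaussian_process M I X \<longleftrightarrow>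
     (\<forall>F a. finite F \<and> F \<subseteq> I \<longrightarrow> centered_gaussian M (\<lambda>\<omega>. \<Sum>i\<in>F. a i * X i \<omega>))"

definition L2_functions :: "'z measure \<Rightarrow> ('z \<Rightarrow> real) set" where
  "L2_functions N = {f \<in> borel_measurable N. integrable N (\<lambda>z. (f z)\<^sup>2)}"

text \<open>
  A white noise \<open>\<xi>\<close> with intensity \<open>N\<close> is given through its stochastic integrals
  \<open>W f = \<integral> f d\<xi>\<close>, the centered Gaussian process indexed by square integrable functions
  whose covariance is the inner product of \<open>L\<^sup>2(N)\<close>.  Almost sure linearity of \<open>W\<close> follows.
\<close>

definition white_noise :: "'w measure \<Rightarrow> 'z measure \<Rightarrow> (('z \<Rightarrow> real) \<Rightarrow> 'w \<Rightarrow> real) \<Rightarrow> bool" where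
  "white_noise M N W \<longleftrightarrow>
     centered_gaussian_process M (L2_functions N) W \<and>
     (\<forall>f\<in>L2_functions N. \<forall>g\<in>L2_functions N.
        (\<integral>\<omega>. W f \<omega> * W g \<omega> \<partial>M) = (\<integral>z. f z * g z \<partial>N))"

definition space_time :: "(plane \<times> real) measure" where
  "space_time = restrict_space lborel (UNIV \<times> {0..})"

definition field_kernel :: "(plane \<Rightarrow> real) \<Rightarrow> nat \<Rightarrow> plane \<Rightarrow> plane \<times> real \<Rightarrow> real" where
  "field_kernel k n x = (\<lambda>(y, t).
     indicator {2 powr (- real n - 1)..1} t * (k ((y - x) /\<^sub>R t) * t powr (- 3 / 2)))"

text \<open>
  A stochastic integral is only determined up to a null set for each \<open>x\<close>, so the smooth field
  is a modification of \<open>x \<mapsto> W (field_kernel k n x)\<close> all of whose sample functions are smooth.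
\<close>

definition phi_field :: "'w measure \<Rightarrow> (plane \<Rightarrow> real) \<Rightarrow> ((plane \<times> real \<Rightarrow> real) \<Rightarrow> 'w \<Rightarrow> real)
    \<Rightarrow> (nat \<Rightarrow> plane \<Rightarrow> 'w \<Rightarrow> real) \<Rightarrow> bool" where
  "phi_field M k W \<phi> \<longleftrightarrow>
     (\<forall>n x. \<phi> n x \<in> borel_measurable M \<and>
            (AE \<omega> in M. \<phi> n x \<omega> = W (field_kernel k n x) \<omega>)) \<and>
     (\<forall>n. \<forall>\<omega>\<in>space M. smooth (\<lambda>x. \<phi> n x \<omega>))"

text \<open>
  Each piece is \<open>C\<^sup>1\<close> up to its endpoints.  The library's \<open>valid_path\<close> allows an unbounded
  derivative near the exceptional points, where the length integral need not exist
  (and a nonexistent integral would count as length 0).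
\<close>

definition piecewise_C1_path :: "(real \<Rightarrow> 'a::real_normed_vector) \<Rightarrow> bool" where
  "piecewise_C1_path p \<longleftrightarrow>
     continuous_on {0..1} p \<and>
     (\<exists>m s. s 0 = 0 \<and> s m = 1 \<and> (\<forall>i<m. s i < s (Suc i)) \<and>
        (\<forall>i<m. \<exists>p'. continuous_on {s i..s (Suc i)} p' \<and>
           (\<forall>t\<in>{s i..s (Suc i)}.
              (p has_vector_derivative p' t) (at t within {s i..s (Suc i)}))))"

definition crossing_paths :: "(real \<Rightarrow> plane) set" where
  "crossing_paths = {p. piecewise_C1_path p \<and> p ` {0..1} \<subseteq> cbox 0 1 \<and> p 0 $ 1 = 0 \<and> p 1 $ 1 = 1}"

definition path_len :: "real \<Rightarrow> (plane \<Rightarrow> real) \<Rightarrow> (real \<Rightarrow> plane) \<Rightarrow> real" where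
  "path_len \<gamma> h p =
     integral {0..1} (\<lambda>t. exp (\<gamma> / 2 * h (p t)) * norm (vector_derivative p (at t)))"

definition lr_length :: "real \<Rightarrow> (plane \<Rightarrow> real) \<Rightarrow> real" where
  "lr_length \<gamma> h = (INF p\<in>crossing_paths. path_len \<gamma> h p)"

definition is_median :: "'w measure \<Rightarrow> ('w \<Rightarrow> real) \<Rightarrow> real \<Rightarrow> bool" where
  "is_median M X m \<longleftrightarrow>
     measure M {\<omega> \<in> space M. X \<omega> \<le> m} \<ge> 1 / 2 \<and>
     measure M {\<omega> \<in> space M. X \<omega> \<ge> m} \<ge> 1 / 2"

end

theory Submission
  imports Defs
begin

text \<open>
  Let \<open>g\<close> be the indicator of a large disc times \<open>[1/2, 1]\<close> and \<open>Z = W g\<close>.  By translation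
  invariance the covariance of \<open>Z\<close> with the field at \<open>x\<close> is a positive constant, the same for all
  \<open>n\<close> and all \<open>x\<close> in the unit square.  Hence on the square the field is a constant multiple of
  \<open>Z\<close> plus a field independent of \<open>Z\<close>, and the crossing length factors as \<open>exp (b * Z)\<close> times a
  length \<open>H\<close> independent of \<open>Z\<close>, where \<open>b\<close> does not depend on \<open>n\<close>.  Since \<open>Z\<close> is bounded by \<open>R\<close>
  with probability at least \<open>3/4\<close>, a median \<open>\<mu>\<close> of the product gives \<open>H \<le> \<mu> * exp (b * R)\<close> with
  probability at least \<open>1/4\<close>, and the lower bound for the Gaussian tail of \<open>Z\<close> transfers to the
  product by independence; the upper tail is symmetric.
\<close>

section \<open>Crossing lengths and their measurability\<close>

text \<open>Adding a constant to the field multiplies the length of every path, hence also the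
  infimum, by one number. That is why the covariance of \<open>Z\<close> with the field has to be
  the same at all points of the square, and why \<open>exp (b * Z)\<close> splits off exactly. The
  slab \<open>[1/2, 1]\<close> is chosen because it lies in the time window of the noise for every
  \<open>n\<close>.

  The main obstacle is the independence of \<open>H\<close> and \<open>Z\<close>. Jointly Gaussian
  uncorrelated variables are independent, but \<open>H\<close> depends on uncountably many values of
  the residual field. Independence is therefore proved for the whole sigma-algebra \<open>N\<close>
  generated by the residual values on the square, and \<open>H\<close> is shown to be measurable for
  \<open>N\<close>: by continuity of the samples it is a pointwise limit of lengths for fields
  interpolated from finitely many of those values. All constants come from the variance of
  \<open>Z\<close> and from \<open>b\<close>, so they depend neither on \<open>n\<close> nor on the
  probability space.\<close>

lemma integrable_mult_path_speed:
  assumes p: "piecewise_C1_path p" and f: "continuous_on {0..1} f"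
  shows "(\<lambda>t. f t * norm (vector_derivative p (at t))) integrable_on {0..1::real}"
proof -
  let ?g = "\<lambda>t. f t * norm (vector_derivative p (at t))"
  from p obtain m s where s0: "s 0 = 0" and sm: "s m = (1::real)"
    and s_less: "\<And>i. i < m \<Longrightarrow> s i < s (Suc i)"
    and C1: "\<And>i. i < m \<Longrightarrow> \<exists>p'. continuous_on {s i..s (Suc i)} p' \<and>
      (\<forall>t\<in>{s i..s (Suc i)}. (p has_vector_derivative p' t) (at t within {s i..s (Suc i)}))"
    unfolding piecewise_C1_path_def by blast
  have mono: "s i \<le> s j" if "i \<le> j" "j \<le> m" for i j
    using that
  proof (induction rule: dec_induct)
    case (step n)
    then show ?case using s_less[of n] by simp
  qed simp
  have "?g integrable_on {0..s i}" if "i \<le> m" for i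
    using that
  proof (induction i)
    case 0
    then show ?case using integrable_on_refl[of ?g 0] by (simp add: s0)
  next
    case (Suc i)
    then have i: "i < m" by simp
    obtain p' where p': "continuous_on {s i..s (Suc i)} p'"
      and der: "\<And>t. t \<in> {s i..s (Suc i)} \<Longrightarrow>
        (p has_vector_derivative p' t) (at t within {s i..s (Suc i)})"
      using C1[OF i] by blast
    have lo: "0 \<le> s i" using mono[of 0 i] i s0 by simp
    have hi: "s (Suc i) \<le> 1" using mono[of "Suc i" m] i sm by simp
    have "?g integrable_on {s i..s (Suc i)}"
    \<comment> \<open>The two-sided derivative equals the continuous \<open>p'\<close> of the piece
      only in the open interval; at a breakpoint the one-sided derivatives may differ, but two
      points do not affect the integral.\<close>
    proof (rule integrable_spike_finite[where S = "{s i, s (Suc i)}" and f = "\<lambda>t. f t * norm (p' t)"])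
      show "?g t = f t * norm (p' t)" if "t \<in> {s i..s (Suc i)} - {s i, s (Suc i)}" for t
      proof -
        have t: "t \<in> {s i<..<s (Suc i)}" using that by auto
        have "(p has_vector_derivative p' t) (at t within {s i<..<s (Suc i)})"
          using der[of t] t by (auto intro: has_vector_derivative_within_subset)
        then have "(p has_vector_derivative p' t) (at t)"
          using t at_within_open[of t "{s i<..<s (Suc i)}"] by simp
        then show ?thesis by (simp add: vector_derivative_at)
      qed
      show "(\<lambda>t. f t * norm (p' t)) integrable_on {s i..s (Suc i)}"
        using lo hi by (intro integrable_continuous_real continuous_intros p' continuous_on_subset[OF f]) auto
    qed auto
    then show ?case
      using Suc i lo s_less[OF i] by (intro Henstock_Kurzweil_Integration.integrable_combine[of 0 "s i" "s (Suc i)"]) auto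
  qed
  from this[of m] show ?thesis by (simp add: sm)
qed

lemma crossing_paths_nonempty: "crossing_paths \<noteq> {}"
proof -
  define e :: plane where "e = axis 1 1"
  define p :: "real \<Rightarrow> plane" where "p t = t *\<^sub>R e" for t
  have e1: "e $ 1 = 1" and e2: "e $ i = (if i = 1 then 1 else 0)" for i
    by (auto simp: e_def axis_def)
  have "piecewise_C1_path p"
    unfolding piecewise_C1_path_def
  proof (intro conjI exI[of _ "1::nat"] exI[of _ "real"] allI impI)
    show "continuous_on {0..1} p" unfolding p_def by (intro continuous_intros)
    fix i
    have "(p has_vector_derivative e) (at t within T)" for t T
      unfolding p_def by (auto intro!: derivative_eq_intros)
    then show "\<exists>p'. continuous_on {real i..real (Suc i)} p' \<and>
        (\<forall>t\<in>{real i..real (Suc i)}. (p has_vector_derivative p' t) (at t within {real i..real (Suc i)}))"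
      by (intro exI[of _ "\<lambda>_. e"]) auto
  qed auto
  moreover have "p ` {0..1} \<subseteq> cbox 0 1"
    by (auto simp: p_def mem_box_cart e2)
  ultimately have "p \<in> crossing_paths"
    by (auto simp: crossing_paths_def p_def e1)
  then show ?thesis by blast
qed

lemma crossing_pathsD:
  assumes "p \<in> crossing_paths"
  shows "piecewise_C1_path p" "continuous_on {0..1} p" "t \<in> {0..1} \<Longrightarrow> p t \<in> cbox 0 1"
  using assms by (auto simp: crossing_paths_def piecewise_C1_path_def)

lemma path_integrand_integrable:
  assumes p: "p \<in> crossing_paths" and h: "continuous_on (cbox 0 1) h"
  shows "(\<lambda>t. exp (\<gamma> / 2 * h (p t)) * norm (vector_derivative p (at t))) integrable_on {0..1::real}"
  using crossing_pathsD[OF p]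
  by (intro integrable_mult_path_speed continuous_intros continuous_on_compose2[OF h]) auto

lemma path_len_nonneg: "0 \<le> path_len \<gamma> h p"
  unfolding path_len_def
  by (cases "(\<lambda>t. exp (\<gamma> / 2 * h (p t)) * norm (vector_derivative p (at t))) integrable_on {0..1}")
     (auto intro: integral_nonneg simp: not_integrable_integral)

lemma lr_length_nonneg: "0 \<le> lr_length \<gamma> h"
  unfolding lr_length_def by (intro cINF_greatest crossing_paths_nonempty path_len_nonneg)

text \<open>The one comparison behind all facts about lengths used here: a constant shift in both
  directions gives the exact scaling, and a small \<open>e\<close> gives continuity under uniform
  convergence. Bounds on the unit square suffice because crossing paths stay inside it.\<close>

lemma lr_length_le_exp_mult:
  assumes h: "continuous_on (cbox 0 1) h" "continuous_on (cbox 0 1) h'" and \<gamma>: "0 < \<gamma>"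
    and le: "\<And>z. z \<in> cbox 0 1 \<Longrightarrow> h z \<le> h' z + e"
  shows "lr_length \<gamma> h \<le> exp (\<gamma> / 2 * e) * lr_length \<gamma> h'"
proof -
  \<comment> \<open>With the factor on the left, this is a lower bound for every
    \<open>path_len \<gamma> h' p\<close>, so the infimum over \<open>p\<close> can be taken
    directly.\<close>
  have "exp (- (\<gamma> / 2 * e)) * lr_length \<gamma> h \<le> path_len \<gamma> h' p" if p: "p \<in> crossing_paths" for p
  proof -
    have "lr_length \<gamma> h \<le> path_len \<gamma> h p"
      unfolding lr_length_def by (intro cINF_lower p bdd_belowI2[of _ 0] path_len_nonneg)
    also have "\<dots> \<le> integral {0..1} (\<lambda>t. exp (\<gamma> / 2 * e) *
        (exp (\<gamma> / 2 * h' (p t)) * norm (vector_derivative p (at t))))"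
      unfolding path_len_def
    proof (intro integral_le path_integrand_integrable p h integrable_on_mult_right)
      fix t :: real assume t: "t \<in> {0..1}"
      have "\<gamma> / 2 * h (p t) \<le> \<gamma> / 2 * (h' (p t) + e)"
        using le[OF crossing_pathsD(3)[OF p t]] \<gamma> by (intro mult_left_mono) auto
      then have "exp (\<gamma> / 2 * h (p t)) \<le> exp (\<gamma> / 2 * e) * exp (\<gamma> / 2 * h' (p t))"
        by (simp add: exp_add[symmetric] distrib_left add.commute)
      then show "exp (\<gamma> / 2 * h (p t)) * norm (vector_derivative p (at t))
          \<le> exp (\<gamma> / 2 * e) * (exp (\<gamma> / 2 * h' (p t)) * norm (vector_derivative p (at t)))"
        by (simp add: mult.assoc[symmetric] mult_right_mono)
    qed
    also have "\<dots> = exp (\<gamma> / 2 * e) * path_len \<gamma> h' p"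
      by (simp add: path_len_def)
    finally show ?thesis by (simp add: exp_minus field_simps)
  qed
  then have "exp (- (\<gamma> / 2 * e)) * lr_length \<gamma> h \<le> lr_length \<gamma> h'"
    unfolding lr_length_def[of _ h'] by (intro cINF_greatest crossing_paths_nonempty)
  then show ?thesis by (simp add: exp_minus field_simps)
qed

lemma lr_length_add_const:
  assumes h: "continuous_on (cbox 0 1) h" and \<gamma>: "0 < \<gamma>"
  shows "lr_length \<gamma> (\<lambda>z. h z + e) = exp (\<gamma> / 2 * e) * lr_length \<gamma> h"
proof (rule antisym)
  have c: "continuous_on (cbox 0 1) (\<lambda>z. h z + e)" using h by (intro continuous_intros)
  show "lr_length \<gamma> (\<lambda>z. h z + e) \<le> exp (\<gamma> / 2 * e) * lr_length \<gamma> h"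
    using lr_length_le_exp_mult[OF c h \<gamma>, of e] by simp
  show "exp (\<gamma> / 2 * e) * lr_length \<gamma> h \<le> lr_length \<gamma> (\<lambda>z. h z + e)"
    using lr_length_le_exp_mult[OF h c \<gamma>, of "- e"] by (simp add: exp_minus field_simps)
qed

text \<open>Lengths are controlled only up to factors close to 1, and the limit \<open>l\<close> may
  be 0, so the squeeze is between \<open>exp (- (\<gamma> / 2 * e)) * l\<close> and
  \<open>exp (\<gamma> / 2 * e) * l\<close> rather than through logarithms.\<close>

lemma tendsto_exp_sandwich:
  fixes f :: "'a \<Rightarrow> real"
  assumes \<gamma>: "0 < \<gamma>"
    and ev: "\<And>e. 0 < e \<Longrightarrow> \<forall>\<^sub>F x in F. l \<le> exp (\<gamma> / 2 * e) * f x \<and> f x \<le> exp (\<gamma> / 2 * e) * l"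
  shows "(f \<longlongrightarrow> l) F"
proof (rule tendstoI)
  fix d :: real assume d: "0 < d"
  have l1: "((\<lambda>e. exp (\<gamma> / 2 * e) * l) \<longlongrightarrow> exp (\<gamma> / 2 * 0) * l) (at_right 0)"
    by (intro tendsto_intros)
  have l2: "((\<lambda>e. exp (- (\<gamma> / 2 * e)) * l) \<longlongrightarrow> exp (- (\<gamma> / 2 * 0)) * l) (at_right 0)"
    by (intro tendsto_intros)
  have "\<forall>\<^sub>F e in at_right 0. dist (exp (\<gamma> / 2 * e) * l) l < d \<and> dist (exp (- (\<gamma> / 2 * e)) * l) l < d \<and> 0 < e"
    using tendstoD[OF l1 d] tendstoD[OF l2 d] eventually_at_right_less[of "0::real"]
    by eventually_elim simp
  then obtain e where e: "dist (exp (\<gamma> / 2 * e) * l) l < d" "dist (exp (- (\<gamma> / 2 * e)) * l) l < d" "0 < e"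
    using eventually_happens'[OF trivial_limit_at_right_real] by blast
  show "\<forall>\<^sub>F x in F. dist (f x) l < d"
    using ev[OF e(3)]
  proof eventually_elim
    case (elim x)
    then have "exp (- (\<gamma> / 2 * e)) * l \<le> f x" by (simp add: exp_minus field_simps)
    then show ?case using e elim by (auto simp: dist_real_def)
  qed
qed

text \<open>Normalized tent functions of radius \<open>d\<close> about the net points, a continuous
  partition of unity wherever the balls cover. Where no net point is within \<open>d\<close> the
  denominator is 0 and all weights are 0, hence the covering hypotheses below.\<close>

definition net_weight :: "nat \<Rightarrow> (nat \<Rightarrow> plane) \<Rightarrow> real \<Rightarrow> nat \<Rightarrow> plane \<Rightarrow> real" where
  "net_weight N x d j z = max 0 (d - dist z (x j)) / (\<Sum>i<N. max 0 (d - dist z (x i)))"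

lemma net_weight_nonneg: "0 \<le> net_weight N x d j z"
  unfolding net_weight_def by (intro divide_nonneg_nonneg sum_nonneg) auto

lemma net_weight_eq_0: "d \<le> dist z (x j) \<Longrightarrow> net_weight N x d j z = 0"
  unfolding net_weight_def by simp

lemma net_weight_denominator_pos:
  fixes N :: nat
  assumes "\<exists>j<N. dist z (x j) < d"
  shows "0 < (\<Sum>i<N. max 0 (d - dist z (x i)))"
proof -
  obtain j where "j < N" "dist z (x j) < d" using assms by blast
  then show ?thesis by (intro sum_pos2[of "{..<N}" j]) auto
qed

lemma sum_net_weight:
  assumes "\<exists>j<N. dist z (x j) < d"
  shows "(\<Sum>i<N. net_weight N x d i z) = 1"
  using net_weight_denominator_pos[OF assms] by (simp add: net_weight_def sum_divide_distrib[symmetric])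

text \<open>The average is a convex combination in which only net points within \<open>d\<close> of
  \<open>z\<close> carry weight, so a bound on the nearby values is enough. This is where uniform
  continuity of the field will enter.\<close>

lemma net_weight_average_le:
  assumes cover: "\<exists>j<N. dist z (x j) < d"
    and le: "\<And>i. i < N \<Longrightarrow> dist z (x i) < d \<Longrightarrow> v i \<le> c"
  shows "(\<Sum>i<N. v i * net_weight N x d i z) \<le> c"
proof -
  have "(\<Sum>i<N. v i * net_weight N x d i z) \<le> (\<Sum>i<N. c * net_weight N x d i z)"
  proof (intro sum_mono)
    fix i assume i: "i \<in> {..<N}"
    show "v i * net_weight N x d i z \<le> c * net_weight N x d i z"
    proof (cases "dist z (x i) < d")
      case True
      then show ?thesis using i le[of i] net_weight_nonneg by (intro mult_right_mono) auto
    next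
      case False
      then show ?thesis by (simp add: net_weight_eq_0)
    qed
  qed
  also have "\<dots> = c" using sum_net_weight[OF cover] by (simp add: sum_distrib_left[symmetric])
  finally show ?thesis .
qed

lemma net_weight_average_ge:
  assumes "\<exists>j<N. dist z (x j) < d"
    and "\<And>i. i < N \<Longrightarrow> dist z (x i) < d \<Longrightarrow> c \<le> v i"
  shows "c \<le> (\<Sum>i<N. v i * net_weight N x d i z)"
  using net_weight_average_le[OF assms(1), of "\<lambda>i. - v i" "- c"] assms(2) by (simp add: sum_negf)

lemma continuous_on_net_weight_average:
  assumes "\<And>z. z \<in> S \<Longrightarrow> \<exists>j<N. dist z (x j) < d"
  shows "continuous_on S (\<lambda>z. \<Sum>i<N. v i * net_weight N x d i z)"
  unfolding net_weight_def
proof (intro continuous_intros ballI)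
  fix z assume "z \<in> S"
  then have "0 < (\<Sum>i<N. max 0 (d - dist z (x i)))"
    by (rule net_weight_denominator_pos[OF assms])
  then show "(\<Sum>i<N. max 0 (d - dist z (x i))) \<noteq> 0" by simp
qed

lemma finite_net:
  fixes S :: "'a::metric_space set"
  assumes "compact S" "0 < d"
  obtains N and x :: "nat \<Rightarrow> 'a" where "\<And>j. j < N \<Longrightarrow> x j \<in> S"
    "\<And>z. z \<in> S \<Longrightarrow> \<exists>j<N. dist z (x j) < d"
proof -
  have "\<exists>k. finite k \<and> k \<subseteq> S \<and> S \<subseteq> (\<Union>x\<in>k. ball x d)"
    using seq_compact_imp_totally_bounded[OF compact_imp_seq_compact[OF assms(1)]] assms(2) by simp
  then obtain k where k: "finite k" "k \<subseteq> S" "S \<subseteq> (\<Union>x\<in>k. ball x d)"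
    by blast
  obtain N and x :: "nat \<Rightarrow> 'a" where Nx: "k = x ` {i. i < N}"
    using finite_imp_nat_seg_image_inj_on[OF k(1)] by blast
  show thesis
  proof (rule that)
    show "x j \<in> S" if "j < N" for j using that k(2) Nx by blast
    show "\<exists>j<N. dist z (x j) < d" if z: "z \<in> S" for z
    proof -
      obtain y where "y \<in> k" "z \<in> ball y d" using k(3) z by blast
      then show ?thesis using Nx by (auto simp: dist_commute)
    qed
  qed
qed

text \<open>The length of an interpolated field is a function \<open>G\<close> of the value vector
  alone. Moving each of the \<open>N\<close> values by at most \<open>e\<close> changes
  \<open>G\<close> by at most a factor \<open>exp (\<gamma> / 2 * e)\<close>, so \<open>G\<close> is
  continuous in the product topology and composes with measurable coordinates.\<close>

lemma borel_measurable_lr_length_net: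
  assumes \<gamma>: "0 < \<gamma>"
    and cover: "\<And>z. z \<in> cbox 0 1 \<Longrightarrow> \<exists>j<N. dist z (x j) < d"
    and meas: "\<And>j. j < N \<Longrightarrow> X j \<in> borel_measurable M"
  shows "(\<lambda>\<omega>. lr_length \<gamma> (\<lambda>z. \<Sum>i<N. X i \<omega> * net_weight N x d i z)) \<in> borel_measurable M"
proof -
  define G where "G v = lr_length \<gamma> (\<lambda>z. \<Sum>i<N. v i * net_weight N x d i z)" for v :: "nat \<Rightarrow> real"
  have cont: "continuous_on (cbox 0 1) (\<lambda>z. \<Sum>i<N. v i * net_weight N x d i z)" for v
    by (rule continuous_on_net_weight_average) (rule cover)
  have le: "G v \<le> exp (\<gamma> / 2 * e) * G w" if vw: "\<And>i. i < N \<Longrightarrow> v i \<le> w i + e" for v w e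
    unfolding G_def
  proof (rule lr_length_le_exp_mult[OF cont cont \<gamma>])
    fix z :: plane assume z: "z \<in> cbox 0 1"
    have "(\<Sum>i<N. v i * net_weight N x d i z) - (\<Sum>i<N. w i * net_weight N x d i z)
        = (\<Sum>i<N. (v i - w i) * net_weight N x d i z)"
      by (simp add: sum_subtractf left_diff_distrib)
    also have "\<dots> \<le> e"
      by (rule net_weight_average_le[OF cover[OF z]]) (use vw in \<open>simp add: algebra_simps\<close>)
    finally show "(\<Sum>i<N. v i * net_weight N x d i z) \<le> (\<Sum>i<N. w i * net_weight N x d i z) + e"
      by simp
  qed
  have G_cont: "continuous_on UNIV G"
  proof (subst continuous_on_def, intro ballI tendsto_exp_sandwich[OF \<gamma>])
    fix v :: "nat \<Rightarrow> real" and e :: real assume "0 < e"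
    have "\<forall>\<^sub>F w in at v. dist (w i) (v i) < e" for i
    proof -
      have "continuous_on UNIV (\<lambda>w::nat \<Rightarrow> real. w i)" by (rule continuous_on_product_coordinates)
      then show ?thesis using \<open>0 < e\<close> by (auto simp: continuous_on_def dest: tendstoD)
    qed
    then have "\<forall>\<^sub>F w in at v. \<forall>i\<in>{..<N}. dist (w i) (v i) < e"
      by (intro eventually_ball_finite) auto
    then show "\<forall>\<^sub>F w in at v. G v \<le> exp (\<gamma> / 2 * e) * G w \<and> G w \<le> exp (\<gamma> / 2 * e) * G v"
    proof eventually_elim
      case (elim w)
      then have "\<bar>w i - v i\<bar> < e" if "i < N" for i using that by (auto simp: dist_real_def)
      then show ?case by (intro conjI le) (fastforce simp: abs_less_iff)+
    qed
  qed
  \<comment> \<open>Only the first \<open>N\<close> coordinates are known to be measurable; the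
    others are set to 0, which \<open>G\<close> does not see.\<close>
  have X_meas: "(\<lambda>\<omega> i. if i < N then X i \<omega> else 0) \<in> borel_measurable M"
  proof (rule measurable_coordinatewise_then_product)
    show "(\<lambda>\<omega>. if i < N then X i \<omega> else 0) \<in> borel_measurable M" for i
      using meas[of i] by (cases "i < N") auto
  qed
  have "(\<lambda>\<omega>. G (\<lambda>i. if i < N then X i \<omega> else 0)) \<in> borel_measurable M"
    by (rule measurable_compose[OF X_meas borel_measurable_continuous_onI[OF G_cont]])
  moreover have "G (\<lambda>i. if i < N then X i \<omega> else 0) =
      lr_length \<gamma> (\<lambda>z. \<Sum>i<N. X i \<omega> * net_weight N x d i z)" for \<omega>
    unfolding G_def by (rule arg_cong[where f = "lr_length \<gamma>"], intro ext sum.cong) auto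
  ultimately show ?thesis by simp
qed

text \<open>The measure space is arbitrary so that the lemma applies both to the probability space
  and to the smaller sigma-algebra generated by the residual field. The nets consist of points of
  the square, where measurability is assumed.\<close>

lemma borel_measurable_lr_length:
  assumes \<gamma>: "0 < \<gamma>"
    and meas: "\<And>z. z \<in> cbox 0 1 \<Longrightarrow> f z \<in> borel_measurable M"
    and cont: "\<And>\<omega>. \<omega> \<in> space M \<Longrightarrow> continuous_on (cbox 0 1) (\<lambda>z. f z \<omega>)"
  shows "(\<lambda>\<omega>. lr_length \<gamma> (\<lambda>z. f z \<omega>)) \<in> borel_measurable M"
proof -
  define net :: "nat \<Rightarrow> nat \<Rightarrow> (nat \<Rightarrow> plane) \<Rightarrow> bool" where
    "net m N x \<longleftrightarrow> (\<forall>j<N. x j \<in> cbox 0 1) \<and>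
      (\<forall>z\<in>cbox 0 1. \<exists>j<N. dist z (x j) < inverse (real (Suc m)))" for m N x
  have ex: "\<exists>N x. net m N x" for m
  proof (rule finite_net[of "cbox 0 (1::plane)" "inverse (real (Suc m))"])
    fix N and x :: "nat \<Rightarrow> plane"
    assume "\<And>j. j < N \<Longrightarrow> x j \<in> cbox 0 1"
      "\<And>z. z \<in> cbox 0 1 \<Longrightarrow> \<exists>j<N. dist z (x j) < inverse (real (Suc m))"
    then have "net m N x" unfolding net_def by blast
    then show ?thesis by blast
  qed (simp_all add: compact_cbox)
  obtain N where "\<forall>m. \<exists>x. net m (N m) x"
    using choice[of "\<lambda>m N. \<exists>x. net m N x"] ex by blast
  then obtain x where net: "\<And>m. net m (N m) (x m)"
    using choice[of "\<lambda>m x. net m (N m) x"] by blast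
  have mem: "\<And>m j. j < N m \<Longrightarrow> x m j \<in> cbox 0 1"
    and cover: "\<And>m z. z \<in> cbox 0 1 \<Longrightarrow> \<exists>j<N m. dist z (x m j) < inverse (real (Suc m))"
    using net by (simp_all add: net_def)
  define g where "g m \<omega> z = (\<Sum>i<N m. f (x m i) \<omega> * net_weight (N m) (x m) (inverse (real (Suc m))) i z)"
    for m \<omega> z
  show ?thesis
  proof (rule borel_measurable_LIMSEQ_real)
    show "(\<lambda>\<omega>. lr_length \<gamma> (g m \<omega>)) \<in> borel_measurable M" for m
      unfolding g_def[abs_def]
      by (rule borel_measurable_lr_length_net[OF \<gamma>]) (erule cover, rule meas, erule mem)
    fix \<omega> assume \<omega>: "\<omega> \<in> space M"
    have gcont: "continuous_on (cbox 0 1) (g m \<omega>)" for m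
      unfolding g_def[abs_def] by (rule continuous_on_net_weight_average) (rule cover)
    show "(\<lambda>m. lr_length \<gamma> (g m \<omega>)) \<longlonglongrightarrow> lr_length \<gamma> (\<lambda>z. f z \<omega>)"
    proof (rule tendsto_exp_sandwich[OF \<gamma>])
      fix e :: real assume e: "0 < e"
      \<comment> \<open>The modulus \<open>d\<close> depends on the sample, so the approximation is
        only pointwise in \<open>\<omega>\<close>; a pointwise limit is all that measurability
        requires.\<close>
      obtain d where d: "0 < d" and unif: "\<And>y z. y \<in> cbox 0 1 \<Longrightarrow> z \<in> cbox 0 1 \<Longrightarrow> dist z y < d \<Longrightarrow> dist (f z \<omega>) (f y \<omega>) < e"
        by (rule uniformly_continuous_onE[OF compact_uniformly_continuous[OF cont[OF \<omega>] compact_cbox] e]) blast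
      have "\<forall>\<^sub>F m in sequentially. inverse (real (Suc m)) < d"
        using order_tendstoD(2)[OF LIMSEQ_inverse_real_of_nat d] .
      then show "\<forall>\<^sub>F m in sequentially. lr_length \<gamma> (\<lambda>z. f z \<omega>) \<le> exp (\<gamma> / 2 * e) * lr_length \<gamma> (g m \<omega>) \<and>
          lr_length \<gamma> (g m \<omega>) \<le> exp (\<gamma> / 2 * e) * lr_length \<gamma> (\<lambda>z. f z \<omega>)"
      proof eventually_elim
        case (elim m)
        have close: "dist (f z \<omega>) (f (x m i) \<omega>) < e"
          if "z \<in> cbox 0 1" "i < N m" "dist z (x m i) < inverse (real (Suc m))" for z i
          using that unif[of "x m i" z] mem elim by auto
        have "f z \<omega> \<le> g m \<omega> z + e" if z: "z \<in> cbox 0 1" for z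
        proof -
          have "f z \<omega> - e \<le> g m \<omega> z"
            unfolding g_def by (rule net_weight_average_ge[OF cover[OF z]]) (use close[OF z] in \<open>fastforce simp: dist_real_def abs_less_iff\<close>)
          then show ?thesis by simp
        qed
        moreover have "g m \<omega> z \<le> f z \<omega> + e" if z: "z \<in> cbox 0 1" for z
        proof -
          show ?thesis
            unfolding g_def by (rule net_weight_average_le[OF cover[OF z]]) (use close[OF z] in \<open>fastforce simp: dist_real_def abs_less_iff\<close>)
        qed
        ultimately show ?case
          by (intro conjI lr_length_le_exp_mult gcont cont[OF \<omega>] \<gamma>) auto
      qed
    qed
  qed
qed

section \<open>Independence from characteristic functions\<close>

text \<open>\<open>1 + U\<close> is the density of a probability measure under which \<open>X\<close> keeps its characteristic
  function, hence its law.\<close>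

lemma (in prob_space) expectation_indicator_eq_0_real:
  fixes U X :: "'a \<Rightarrow> real"
  assumes X[measurable]: "X \<in> borel_measurable M" and U[measurable]: "U \<in> borel_measurable M"
    and bound: "\<And>\<omega>. \<omega> \<in> space M \<Longrightarrow> \<bar>U \<omega>\<bar> \<le> 1"
    and zero: "\<And>t. (\<integral>\<omega>. complex_of_real (U \<omega>) * iexp (t * X \<omega>) \<partial>M) = 0"
    and B[measurable]: "B \<in> sets borel"
  shows "(\<integral>\<omega>. U \<omega> * indicator B (X \<omega>) \<partial>M) = 0"
proof -
  have U_int: "integrable M (\<lambda>\<omega>. U \<omega> * f \<omega>)" if "f \<in> borel_measurable M" "\<And>\<omega>. \<bar>f \<omega>\<bar> \<le> 1"
    for f :: "'a \<Rightarrow> real"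
    using that bound
    by (intro integrable_const_bound[of _ 1]) (auto simp: abs_mult intro!: AE_I2 mult_le_one)
  define D where "D = density M (\<lambda>\<omega>. ennreal (1 + U \<omega>))"
  have nonneg: "AE \<omega> in M. 0 \<le> 1 + U \<omega>" using bound by (intro AE_I2) (force simp: abs_le_iff)
  have sets_D[measurable_cong]: "sets D = sets M" by (simp add: D_def)
  \<comment> \<open>The case \<open>t = 0\<close> of the hypothesis says that \<open>U\<close> has
    mean 0, which gives the density \<open>1 + U\<close> total mass 1.\<close>
  have "complex_of_real (\<integral>\<omega>. U \<omega> \<partial>M) = 0"
    using zero[of 0] by (simp add: integral_complex_of_real)
  then have "(\<integral>\<omega>. 1 + U \<omega> \<partial>M) = 1"
    using U_int[of "\<lambda>_. 1"] by (simp add: prob_space)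
  then have "emeasure D (space D) = 1"
    using nonneg U_int[of "\<lambda>_. 1"] by (simp add: D_def emeasure_density nn_integral_eq_integral)
  then interpret D: prob_space D by (rule prob_spaceI)
  have "char (distr D borel X) t = char (distr M borel X) t" for t
  proof -
    have i1: "integrable M (\<lambda>\<omega>. iexp (t * X \<omega>))" using integrable_iexp[of "\<lambda>\<omega>. t * X \<omega>"] by simp
    have i2: "integrable M (\<lambda>\<omega>. complex_of_real (U \<omega>) * iexp (t * X \<omega>))"
      using bound by (intro integrable_const_bound[of _ 1]) (auto simp: norm_mult)
    have "char (distr D borel X) t = (\<integral>\<omega>. iexp (t * X \<omega>) \<partial>D)"
      by (simp add: char_def integral_distr)
    also have "\<dots> = (\<integral>\<omega>. (1 + U \<omega>) *\<^sub>R iexp (t * X \<omega>) \<partial>M)"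
      unfolding D_def using nonneg by (subst integral_density) auto
    also have "\<dots> = (\<integral>\<omega>. iexp (t * X \<omega>) + complex_of_real (U \<omega>) * iexp (t * X \<omega>) \<partial>M)"
      by (simp add: scaleR_conv_of_real distrib_right)
    also have "\<dots> = (\<integral>\<omega>. iexp (t * X \<omega>) \<partial>M)"
      using i1 i2 zero[of t] by simp
    also have "\<dots> = char (distr M borel X) t" by (simp add: char_def integral_distr)
    finally show ?thesis .
  qed
  then have eq: "distr D borel X = distr M borel X"
    by (intro Levy_uniqueness ext real_distribution_distr D.real_distribution_distr) simp_all
  have "(\<integral>\<omega>. indicator B (X \<omega>) \<partial>D) = (\<integral>x. indicator B x \<partial>distr D borel X :: real)"
    by (rule integral_distr[symmetric]) measurable
  also have "\<dots> = (\<integral>\<omega>. indicator B (X \<omega>) \<partial>M)"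
    unfolding eq by (rule integral_distr) measurable
  finally have "(\<integral>\<omega>. (1 + U \<omega>) *\<^sub>R (indicator B (X \<omega>) :: real) \<partial>M) = (\<integral>\<omega>. indicator B (X \<omega>) \<partial>M)"
    unfolding D_def using nonneg by (subst (asm) integral_density) auto
  then have "(\<integral>\<omega>. indicator B (X \<omega>) + U \<omega> * indicator B (X \<omega>) \<partial>M) = (\<integral>\<omega>. indicator B (X \<omega>) \<partial>M)"
    by (simp add: distrib_right)
  moreover have "integrable M (\<lambda>\<omega>. indicator B (X \<omega>) :: real)"
    by (intro integrable_const_bound[of _ 1]) (auto simp: indicator_def)
  moreover have "integrable M (\<lambda>\<omega>. U \<omega> * indicator B (X \<omega>))"
    by (intro U_int) (auto simp: indicator_def)
  ultimately show ?thesis by simp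
qed

text \<open>Reduction to the real case through real and imaginary parts. The real part of
  \<open>V\<close> inherits the hypothesis because conjugation turns frequency \<open>t\<close> into
  \<open>- t\<close> and all frequencies are covered.\<close>

lemma (in prob_space) expectation_indicator_eq_0:
  fixes U :: "'a \<Rightarrow> complex" and X :: "'a \<Rightarrow> real"
  assumes X[measurable]: "X \<in> borel_measurable M" and U[measurable]: "U \<in> borel_measurable M"
    and bound: "\<And>\<omega>. \<omega> \<in> space M \<Longrightarrow> norm (U \<omega>) \<le> 1"
    and zero: "\<And>t. (\<integral>\<omega>. U \<omega> * iexp (t * X \<omega>) \<partial>M) = 0"
    and B[measurable]: "B \<in> sets borel"
  shows "(\<integral>\<omega>. U \<omega> * indicator B (X \<omega>) \<partial>M) = 0"
proof -
  have int: "integrable M (\<lambda>\<omega>. V \<omega> * W \<omega>)"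
    if "V \<in> borel_measurable M" "W \<in> borel_measurable M"
      "\<And>\<omega>. \<omega> \<in> space M \<Longrightarrow> norm (V \<omega>) \<le> 1" "\<And>\<omega>. \<omega> \<in> space M \<Longrightarrow> norm (W \<omega>) \<le> 1"
    for V W :: "'a \<Rightarrow> complex"
    using that by (intro integrable_const_bound[of _ 1]) (auto simp: norm_mult intro!: AE_I2 mult_le_one)
  have Re_zero: "(\<integral>\<omega>. Re (V \<omega>) * indicator B (X \<omega>) \<partial>M) = 0"
    if V[measurable]: "V \<in> borel_measurable M" and V1: "\<And>\<omega>. \<omega> \<in> space M \<Longrightarrow> norm (V \<omega>) \<le> 1"
      and V0: "\<And>t. (\<integral>\<omega>. V \<omega> * iexp (t * X \<omega>) \<partial>M) = 0" for V
  proof (rule expectation_indicator_eq_0_real)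
    show "\<bar>Re (V \<omega>)\<bar> \<le> 1" if "\<omega> \<in> space M" for \<omega>
      using abs_Re_le_cmod[of "V \<omega>"] V1[OF that] by linarith
    fix t
    have cV[measurable]: "(\<lambda>\<omega>. cnj (V \<omega>)) \<in> borel_measurable M"
      by (intro borel_measurable_continuous_on[OF _ V] continuous_intros)
    have i1: "integrable M (\<lambda>\<omega>. V \<omega> * iexp (t * X \<omega>))"
      and i2: "integrable M (\<lambda>\<omega>. cnj (V \<omega>) * iexp (t * X \<omega>))"
      by (rule int; simp add: V1)+
    have "(\<integral>\<omega>. cnj (V \<omega>) * iexp (t * X \<omega>) \<partial>M) = (\<integral>\<omega>. cnj (V \<omega> * iexp ((- t) * X \<omega>)) \<partial>M)"
      by (simp add: exp_cnj)
    also have "\<dots> = cnj (\<integral>\<omega>. V \<omega> * iexp ((- t) * X \<omega>) \<partial>M)" by (rule Bochner_Integration.integral_cnj)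
    also have "\<dots> = 0" by (subst V0) simp
    finally have z: "(\<integral>\<omega>. cnj (V \<omega>) * iexp (t * X \<omega>) \<partial>M) = 0" .
    have "(\<integral>\<omega>. complex_of_real (Re (V \<omega>)) * iexp (t * X \<omega>) \<partial>M)
        = (\<integral>\<omega>. (1 / 2) * (V \<omega> * iexp (t * X \<omega>) + cnj (V \<omega>) * iexp (t * X \<omega>)) \<partial>M)"
    proof (rule Bochner_Integration.integral_cong[OF refl])
      fix \<omega>
      have "complex_of_real (Re (V \<omega>)) = (1 / 2) * (V \<omega> + cnj (V \<omega>))"
        by (simp add: complex_add_cnj)
      then show "complex_of_real (Re (V \<omega>)) * iexp (t * X \<omega>)
          = (1 / 2) * (V \<omega> * iexp (t * X \<omega>) + cnj (V \<omega>) * iexp (t * X \<omega>))"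
        by (simp only: distrib_left distrib_right mult.assoc)
    qed
    also have "\<dots> = 0"
      by (subst integral_mult_right_zero, subst Bochner_Integration.integral_add[OF i1 i2])
         (simp only: z V0, simp)
    finally show "(\<integral>\<omega>. complex_of_real (Re (V \<omega>)) * iexp (t * X \<omega>) \<partial>M) = 0" .
  qed measurable
  \<comment> \<open>The imaginary part of \<open>U\<close> is the real part of
    \<open>- \<i> * U\<close>, which satisfies the same hypotheses.\<close>
  have "(\<integral>\<omega>. Re (- \<i> * U \<omega>) * indicator B (X \<omega>) \<partial>M) = 0"
  proof (rule Re_zero)
    show "(\<integral>\<omega>. - \<i> * U \<omega> * iexp (t * X \<omega>) \<partial>M) = 0" for t
      by (simp only: mult.assoc integral_mult_right_zero zero mult_zero_right)
  qed (use bound in \<open>simp_all add: norm_mult\<close>)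
  then have Im0: "(\<integral>\<omega>. Im (U \<omega>) * indicator B (X \<omega>) \<partial>M) = 0" by simp
  have Re0: "(\<integral>\<omega>. Re (U \<omega>) * indicator B (X \<omega>) \<partial>M) = 0"
    using bound zero by (intro Re_zero) auto
  have i: "integrable M (\<lambda>\<omega>. U \<omega> * indicator B (X \<omega>))"
    using bound by (intro int) (auto simp: indicator_def)
  have "Re (\<integral>\<omega>. U \<omega> * indicator B (X \<omega>) \<partial>M) = 0"
  proof -
    have "Re (\<integral>\<omega>. U \<omega> * indicator B (X \<omega>) \<partial>M) = (\<integral>\<omega>. Re (U \<omega> * indicator B (X \<omega>)) \<partial>M)"
      using i by (rule integral_Re[symmetric])
    also have "\<dots> = (\<integral>\<omega>. Re (U \<omega>) * indicator B (X \<omega>) \<partial>M)"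
      by (intro Bochner_Integration.integral_cong refl) (simp add: indicator_def)
    finally show ?thesis using Re0 by simp
  qed
  moreover have "Im (\<integral>\<omega>. U \<omega> * indicator B (X \<omega>) \<partial>M) = 0"
  proof -
    have "Im (\<integral>\<omega>. U \<omega> * indicator B (X \<omega>) \<partial>M) = (\<integral>\<omega>. Im (U \<omega> * indicator B (X \<omega>)) \<partial>M)"
      using i by (rule integral_Im[symmetric])
    also have "\<dots> = (\<integral>\<omega>. Im (U \<omega>) * indicator B (X \<omega>) \<partial>M)"
      by (intro Bochner_Integration.integral_cong refl) (simp add: indicator_def)
    finally show ?thesis using Im0 by simp
  qed
  ultimately show ?thesis by (simp add: complex_eq_iff)
qed

text \<open>Exponentials are exchanged for indicators one coordinate at a time, so that uniqueness
  of characteristic functions is used only on the line. \<open>F\<close> holds the coordinates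
  already exchanged and \<open>J\<close> those still in the exponent; the induction needs arbitrary
  \<open>J\<close> and \<open>s\<close>, since each step puts the new coordinate back into the
  exponent with a free frequency.\<close>

lemma (in prob_space) expectation_prod_indicator_eq_0:
  fixes Y :: "'i \<Rightarrow> 'a \<Rightarrow> real" and V :: "'a \<Rightarrow> complex"
  assumes V[measurable]: "V \<in> borel_measurable M"
    and Y: "\<And>i. i \<in> I \<Longrightarrow> Y i \<in> borel_measurable M"
    and bound: "\<And>\<omega>. \<omega> \<in> space M \<Longrightarrow> norm (V \<omega>) \<le> 1"
    and zero: "\<And>J s. finite J \<Longrightarrow> J \<subseteq> I \<Longrightarrow> (\<integral>\<omega>. V \<omega> * iexp (\<Sum>j\<in>J. s j * Y j \<omega>) \<partial>M) = 0"
    and A: "\<And>i. A i \<in> sets borel"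
    and F: "finite F" "F \<subseteq> I" and J: "finite J" "J \<subseteq> I" "J \<inter> F = {}"
  shows "(\<integral>\<omega>. V \<omega> * (\<Prod>i\<in>F. indicator (A i) (Y i \<omega>)) * iexp (\<Sum>j\<in>J. s j * Y j \<omega>) \<partial>M) = 0"
  using F J
proof (induction F arbitrary: J s rule: finite_induct)
  case empty
  then show ?case using zero by simp
next
  case (insert x F)
  define U where "U \<omega> = V \<omega> * (\<Prod>i\<in>F. indicator (A i) (Y i \<omega>)) * iexp (\<Sum>j\<in>J. s j * Y j \<omega>)" for \<omega>
  have [measurable]: "(\<lambda>\<omega>. indicator (A i) (Y i \<omega>) :: complex) \<in> borel_measurable M" if "i \<in> I" for i
    using Y[OF that] A[of i] by measurable
  have [measurable]: "(\<lambda>\<omega>. \<Prod>i\<in>F. indicator (A i) (Y i \<omega>) :: complex) \<in> borel_measurable M"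
    using insert by (intro borel_measurable_prod) auto
  have [measurable]: "(\<lambda>\<omega>. \<Sum>j\<in>J. s j * Y j \<omega>) \<in> borel_measurable M"
    using insert Y by (intro borel_measurable_sum borel_measurable_times) auto
  have "(\<integral>\<omega>. U \<omega> * indicator (A x) (Y x \<omega>) \<partial>M) = 0"
  proof (rule expectation_indicator_eq_0)
    show "Y x \<in> borel_measurable M" using insert Y by auto
    show "U \<in> borel_measurable M" unfolding U_def[abs_def] by measurable
    show "A x \<in> sets borel" by (rule A)
    show "norm (U \<omega>) \<le> 1" if "\<omega> \<in> space M" for \<omega>
    proof -
      have "norm (\<Prod>i\<in>F. indicator (A i) (Y i \<omega>) :: complex) \<le> 1"
        by (subst prod_norm[symmetric], rule prod_le_1) (auto simp: indicator_def)
      then show ?thesis unfolding U_def using bound[OF that]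
        by (simp add: norm_mult mult_le_one)
    qed
    fix t
    \<comment> \<open>Since \<open>x\<close> is not in \<open>J\<close>, the frequency of
      \<open>x\<close> is free, and changing it leaves the sum over \<open>J\<close> alone.\<close>
    define s' where "s' = s(x := t)"
    have x: "x \<notin> J" using insert by auto
    have "U \<omega> * iexp (t * Y x \<omega>) = V \<omega> * (\<Prod>i\<in>F. indicator (A i) (Y i \<omega>)) *
        iexp (\<Sum>j\<in>insert x J. s' j * Y j \<omega>)" for \<omega>
    proof -
      have "(\<Sum>j\<in>insert x J. s' j * Y j \<omega>) = (\<Sum>j\<in>J. s' j * Y j \<omega>) + t * Y x \<omega>"
        using insert x by (simp add: s'_def)
      also have "(\<Sum>j\<in>J. s' j * Y j \<omega>) = (\<Sum>j\<in>J. s j * Y j \<omega>)"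
        using x by (intro sum.cong) (auto simp: s'_def)
      finally have "iexp (\<Sum>j\<in>insert x J. s' j * Y j \<omega>) = iexp (\<Sum>j\<in>J. s j * Y j \<omega>) * iexp (t * Y x \<omega>)"
        by (simp only: of_real_add distrib_left exp_add)
      then show ?thesis by (simp only: U_def mult.assoc)
    qed
    moreover have "(\<integral>\<omega>. V \<omega> * (\<Prod>i\<in>F. indicator (A i) (Y i \<omega>)) *
        iexp (\<Sum>j\<in>insert x J. s' j * Y j \<omega>) \<partial>M) = 0"
      using insert.prems insert.hyps by (intro insert.IH) auto
    ultimately show "(\<integral>\<omega>. U \<omega> * iexp (t * Y x \<omega>) \<partial>M) = 0" by (simp only:)
  qed
  moreover have "U \<omega> * indicator (A x) (Y x \<omega>) = V \<omega> * (\<Prod>i\<in>insert x F. indicator (A i) (Y i \<omega>)) *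
      iexp (\<Sum>j\<in>J. s j * Y j \<omega>)" for \<omega>
    using insert.hyps by (simp add: U_def mult_ac)
  ultimately show ?case by (simp only:)
qed

text \<open>Independence means that the centered indicator \<open>V\<close> of the event for
  \<open>Z\<close> integrates to 0 against every cylinder. The factorization of characteristic
  functions is used twice: first the exponential in \<open>Z\<close> becomes an indicator with the
  \<open>Y i\<close> still in the exponent, then the \<open>Y i\<close> follow one by one.\<close>

lemma (in prob_space) prob_cylinder_indep:
  fixes Y :: "'i \<Rightarrow> 'a \<Rightarrow> real" and Z :: "'a \<Rightarrow> real"
  assumes Y: "\<And>i. i \<in> I \<Longrightarrow> Y i \<in> borel_measurable M"
    and Z[measurable]: "Z \<in> borel_measurable M"
    and char_mult: "\<And>J s t. finite J \<Longrightarrow> J \<subseteq> I \<Longrightarrow>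
      (\<integral>\<omega>. iexp ((\<Sum>j\<in>J. s j * Y j \<omega>) + t * Z \<omega>) \<partial>M) =
      (\<integral>\<omega>. iexp (\<Sum>j\<in>J. s j * Y j \<omega>) \<partial>M) * (\<integral>\<omega>. iexp (t * Z \<omega>) \<partial>M)"
    and A: "\<And>i. A i \<in> sets borel" and B[measurable]: "B \<in> sets borel"
    and F: "finite F" "F \<subseteq> I"
  shows "prob {\<omega> \<in> space M. (\<forall>i\<in>F. Y i \<omega> \<in> A i) \<and> Z \<omega> \<in> B} =
    prob {\<omega> \<in> space M. \<forall>i\<in>F. Y i \<omega> \<in> A i} * prob {\<omega> \<in> space M. Z \<omega> \<in> B}"
proof -
  define b where "b = prob {\<omega> \<in> space M. Z \<omega> \<in> B}"
  have int: "integrable M (\<lambda>\<omega>. V \<omega> * W \<omega>)"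
    if "V \<in> borel_measurable M" "W \<in> borel_measurable M"
      "\<And>\<omega>. \<omega> \<in> space M \<Longrightarrow> norm (V \<omega>) \<le> 1" "\<And>\<omega>. \<omega> \<in> space M \<Longrightarrow> norm (W \<omega>) \<le> 1"
    for V W :: "'a \<Rightarrow> complex"
    using that by (intro integrable_const_bound[of _ 1]) (auto simp: norm_mult intro!: AE_I2 mult_le_one)
  have expectation_indicator: "(\<integral>\<omega>. indicator S \<omega> \<partial>M) = complex_of_real (prob S)" if "S \<in> sets M" for S
  proof -
    have "(\<integral>\<omega>. indicator S \<omega> \<partial>M) = (\<integral>\<omega>. complex_of_real (indicator S \<omega>) \<partial>M)"
      by (intro Bochner_Integration.integral_cong) (auto simp: indicator_def)
    then show ?thesis using that by (simp add: integral_complex_of_real sets.sets_into_space Int_absorb2)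
  qed
  have EB: "(\<integral>\<omega>. indicator B (Z \<omega>) \<partial>M) = complex_of_real b"
  proof -
    have "(\<integral>\<omega>. indicator B (Z \<omega>) \<partial>M) = (\<integral>\<omega>. indicator {\<omega> \<in> space M. Z \<omega> \<in> B} \<omega> \<partial>M :: complex)"
      by (intro Bochner_Integration.integral_cong) (auto simp: indicator_def)
    then show ?thesis by (simp add: expectation_indicator b_def)
  qed
  define V where "V \<omega> = indicator B (Z \<omega>) - complex_of_real b" for \<omega>
  have [measurable]: "V \<in> borel_measurable M" unfolding V_def[abs_def] by measurable
  have Y_zero: "(\<integral>\<omega>. V \<omega> * iexp (\<Sum>j\<in>J. s j * Y j \<omega>) \<partial>M) = 0" if J: "finite J" "J \<subseteq> I" for J s
  proof -
    define S where "S \<omega> = (\<Sum>j\<in>J. s j * Y j \<omega>)" for \<omega>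
    define m where "m = (\<integral>\<omega>. iexp (S \<omega>) \<partial>M)"
    have [measurable]: "S \<in> borel_measurable M"
      unfolding S_def[abs_def] using J Y by (intro borel_measurable_sum borel_measurable_times) auto
    have iS: "integrable M (\<lambda>\<omega>. iexp (S \<omega>))" using integrable_iexp[of S] by simp
    have "norm m \<le> (\<integral>\<omega>. norm (iexp (S \<omega>)) \<partial>M)"
      unfolding m_def by (rule integral_norm_bound)
    then have m1: "norm m \<le> 1" by (simp add: prob_space)
    \<comment> \<open>The exponential minus its mean has norm at most 2; halving it meets the bound
      1 required by the lemma. The assumed factorization says exactly that it is orthogonal to every
      exponential in \<open>Z\<close>.\<close>
    have "(\<integral>\<omega>. (iexp (S \<omega>) - m) / 2 * indicator B (Z \<omega>) \<partial>M) = 0"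
    proof (rule expectation_indicator_eq_0)
      show "norm ((iexp (S \<omega>) - m) / 2) \<le> 1" for \<omega>
        using norm_triangle_ineq4[of "iexp (S \<omega>)" m] m1 by (simp add: norm_divide)
      fix t
      have i1: "integrable M (\<lambda>\<omega>. iexp (S \<omega>) * iexp (t * Z \<omega>))" by (rule int) auto
      have i2: "integrable M (\<lambda>\<omega>. iexp (t * Z \<omega>))" using integrable_iexp[of "\<lambda>\<omega>. t * Z \<omega>"] by simp
      have "(\<integral>\<omega>. (iexp (S \<omega>) - m) / 2 * iexp (t * Z \<omega>) \<partial>M)
          = (\<integral>\<omega>. (1 / 2) * (iexp (S \<omega>) * iexp (t * Z \<omega>) - m * iexp (t * Z \<omega>)) \<partial>M)"
        by (intro Bochner_Integration.integral_cong refl) (simp add: field_simps)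
      also have "\<dots> = (1 / 2) * ((\<integral>\<omega>. iexp (S \<omega>) * iexp (t * Z \<omega>) \<partial>M) - m * (\<integral>\<omega>. iexp (t * Z \<omega>) \<partial>M))"
        using i1 i2 by (subst integral_mult_right_zero, subst Bochner_Integration.integral_diff) auto
      also have "(\<integral>\<omega>. iexp (S \<omega>) * iexp (t * Z \<omega>) \<partial>M) = m * (\<integral>\<omega>. iexp (t * Z \<omega>) \<partial>M)"
        using char_mult[OF J, of s t]
        unfolding m_def S_def by (simp only: of_real_add distrib_left exp_add)
      finally show "(\<integral>\<omega>. (iexp (S \<omega>) - m) / 2 * iexp (t * Z \<omega>) \<partial>M) = 0" by simp
    qed measurable
    moreover have i3: "integrable M (\<lambda>\<omega>. iexp (S \<omega>) * indicator B (Z \<omega>))"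
      by (rule int) (auto simp: indicator_def)
    moreover have i4: "integrable M (\<lambda>\<omega>. indicator B (Z \<omega>) :: complex)"
      by (intro integrable_const_bound[of _ 1]) (auto simp: indicator_def)
    moreover have "(\<integral>\<omega>. (iexp (S \<omega>) - m) / 2 * indicator B (Z \<omega>) \<partial>M)
        = (\<integral>\<omega>. (1 / 2) * (iexp (S \<omega>) * indicator B (Z \<omega>) - m * indicator B (Z \<omega>)) \<partial>M)"
      by (intro Bochner_Integration.integral_cong refl) (simp add: field_simps)
    ultimately have eq: "(\<integral>\<omega>. iexp (S \<omega>) * indicator B (Z \<omega>) \<partial>M) = m * complex_of_real b"
      by (simp add: EB)
    have "(\<integral>\<omega>. V \<omega> * iexp (S \<omega>) \<partial>M)
        = (\<integral>\<omega>. iexp (S \<omega>) * indicator B (Z \<omega>) - iexp (S \<omega>) * complex_of_real b \<partial>M)"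
      by (intro Bochner_Integration.integral_cong refl) (simp add: V_def algebra_simps)
    also have "\<dots> = 0"
      using i3 iS by (subst Bochner_Integration.integral_diff) (auto simp: eq m_def)
    finally show ?thesis by (simp only: S_def)
  qed
  have bound: "norm (V \<omega>) \<le> 1" for \<omega>
  proof -
    have "V \<omega> = complex_of_real (indicator B (Z \<omega>) - b)" by (simp add: V_def indicator_def)
    then have "norm (V \<omega>) = \<bar>indicator B (Z \<omega>) - b\<bar>" by (simp only: norm_of_real)
    also have "\<dots> \<le> 1" unfolding b_def by (auto simp: indicator_def)
    finally show ?thesis .
  qed
  define S where "S = {\<omega> \<in> space M. \<forall>i\<in>F. Y i \<omega> \<in> A i}"
  have S[measurable]: "S \<in> sets M"
  proof -
    have "{\<omega> \<in> space M. Y i \<omega> \<in> A i} \<in> sets M" if "i \<in> F" for i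
      using measurable_sets_Collect[of "Y i" M borel "\<lambda>x. x \<in> A i"] Y[of i] A[of i] F that by auto
    then show ?thesis unfolding S_def using F(1) by (intro sets.sets_Collect_finite_All) auto
  qed
  have prod_ind: "(\<Prod>i\<in>F. indicator (A i) (Y i \<omega>) :: complex) = indicator S \<omega>" if \<omega>: "\<omega> \<in> space M" for \<omega>
  proof (cases "\<omega> \<in> S")
    case True
    then show ?thesis by (simp add: S_def)
  next
    case False
    then obtain i where "i \<in> F" "Y i \<omega> \<notin> A i" using \<omega> by (auto simp: S_def)
    then have "(\<Prod>i\<in>F. indicator (A i) (Y i \<omega>) :: complex) = 0"
      using F(1) by (intro prod_zero bexI[of _ i]) auto
    then show ?thesis using False by simp
  qed
  \<comment> \<open>With \<open>J\<close> empty every coordinate has been exchanged and the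
    remaining exponential is 1.\<close>
  have "(\<integral>\<omega>. V \<omega> * (\<Prod>i\<in>F. indicator (A i) (Y i \<omega>)) * iexp (\<Sum>j\<in>{}. 0 * Y j \<omega>) \<partial>M) = 0"
    by (rule expectation_prod_indicator_eq_0[OF _ Y bound Y_zero A F]) simp_all
  also have "(\<integral>\<omega>. V \<omega> * (\<Prod>i\<in>F. indicator (A i) (Y i \<omega>)) * iexp (\<Sum>j\<in>{}. 0 * Y j \<omega>) \<partial>M)
      = (\<integral>\<omega>. indicator (S \<inter> {\<omega> \<in> space M. Z \<omega> \<in> B}) \<omega> - complex_of_real b * indicator S \<omega> \<partial>M)"
    by (intro Bochner_Integration.integral_cong) (auto simp: V_def prod_ind split: split_indicator)
  also have "\<dots> = complex_of_real (prob (S \<inter> {\<omega> \<in> space M. Z \<omega> \<in> B}) - b * prob S)"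
  proof -
    have int_ind: "integrable M (\<lambda>\<omega>. indicator T \<omega> :: complex)" if "T \<in> sets M" for T
      using that by (intro integrable_const_bound[of _ 1]) (auto split: split_indicator)
    have "integrable M (\<lambda>\<omega>. indicator (S \<inter> {\<omega> \<in> space M. Z \<omega> \<in> B}) \<omega> :: complex)"
      "integrable M (\<lambda>\<omega>. complex_of_real b * indicator S \<omega>)"
      by (intro int_ind integrable_mult_right; measurable)+
    from Bochner_Integration.integral_diff[OF this] show ?thesis
      by (simp add: expectation_indicator)
  qed
  finally have "prob (S \<inter> {\<omega> \<in> space M. Z \<omega> \<in> B}) = b * prob S" by (simp only: of_real_eq_0_iff right_minus_eq)
  moreover have "S \<inter> {\<omega> \<in> space M. Z \<omega> \<in> B} = {\<omega> \<in> space M. (\<forall>i\<in>F. Y i \<omega> \<in> A i) \<and> Z \<omega> \<in> B}"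
    by (auto simp: S_def)
  ultimately show ?thesis by (simp add: S_def b_def)
qed

text \<open>Cylinders over finitely many coordinates form an intersection-stable generator, so their
  independence from \<open>Z\<close> passes to the generated sigma-algebra. Only the measurable sets
  of \<open>N\<close> matter, not its measure. Quantifying over all \<open>H\<close> measurable for
  \<open>N\<close> admits functionals of uncountably many coordinates, such as the crossing
  length.\<close>

lemma (in prob_space) indep_sigma_algebra_exists:
  fixes Y :: "'i \<Rightarrow> 'a \<Rightarrow> real" and Z :: "'a \<Rightarrow> real"
  assumes Y: "\<And>i. i \<in> I \<Longrightarrow> Y i \<in> borel_measurable M"
    and Z[measurable]: "Z \<in> borel_measurable M"
    and char_mult: "\<And>J s t. finite J \<Longrightarrow> J \<subseteq> I \<Longrightarrow>
      (\<integral>\<omega>. iexp ((\<Sum>j\<in>J. s j * Y j \<omega>) + t * Z \<omega>) \<partial>M) =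
      (\<integral>\<omega>. iexp (\<Sum>j\<in>J. s j * Y j \<omega>) \<partial>M) * (\<integral>\<omega>. iexp (t * Z \<omega>) \<partial>M)"
  obtains N where "space N = space M" "\<And>i. i \<in> I \<Longrightarrow> Y i \<in> borel_measurable N"
    "\<And>H A B. H \<in> borel_measurable N \<Longrightarrow> A \<in> sets borel \<Longrightarrow> B \<in> sets borel \<Longrightarrow>
      prob {\<omega> \<in> space M. (H \<omega> :: real) \<in> A \<and> Z \<omega> \<in> B} =
      prob {\<omega> \<in> space M. H \<omega> \<in> A} * prob {\<omega> \<in> space M. Z \<omega> \<in> B}"
proof -
  define cyl where "cyl F A = {\<omega> \<in> space M. \<forall>i\<in>F. Y i \<omega> \<in> A i}" for F :: "'i set" and A :: "'i \<Rightarrow> real set"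
  define E where "E = {cyl F A | F A. finite F \<and> F \<subseteq> I \<and> (\<forall>i. A i \<in> sets borel)}"
  define E' where "E' = {Z -` B \<inter> space M | B. B \<in> sets borel}"
  define N where "N = sigma (space M) E"
  have E_sub: "E \<subseteq> Pow (space M)" by (auto simp: E_def cyl_def)
  have E_sets: "E \<subseteq> sets M"
  proof
    fix S assume "S \<in> E"
    then obtain F A where S: "S = cyl F A" "finite F" "F \<subseteq> I" "\<And>i. A i \<in> sets borel"
      by (auto simp: E_def)
    have "{\<omega> \<in> space M. Y i \<omega> \<in> A i} \<in> sets M" if "i \<in> F" for i
      using measurable_sets_Collect[of "Y i" M borel "\<lambda>x. x \<in> A i"] Y[of i] S that by auto
    then show "S \<in> sets M" unfolding S(1) cyl_def using S(2) by (intro sets.sets_Collect_finite_All) auto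
  qed
  have E_stable: "Int_stable E"
  proof (rule Int_stableI)
    fix S T assume "S \<in> E" "T \<in> E"
    then obtain F A G B where S: "S = cyl F A" "finite F" "F \<subseteq> I" "\<And>i. A i \<in> sets borel"
      and T: "T = cyl G B" "finite G" "G \<subseteq> I" "\<And>i. B i \<in> sets borel"
      by (auto simp: E_def)
    \<comment> \<open>Conditions missing from one cylinder are filled in with \<open>UNIV\<close>,
      which turns the intersection into a cylinder over the union of the index sets.\<close>
    define C where "C i = (if i \<in> F then A i else UNIV) \<inter> (if i \<in> G then B i else UNIV)" for i
    have "S \<inter> T = cyl (F \<union> G) C" unfolding S T cyl_def C_def by auto
    moreover have "C i \<in> sets borel" for i unfolding C_def using S(4) T(4) by auto
    ultimately show "S \<inter> T \<in> E" unfolding E_def using S(2,3) T(2,3) by blast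
  qed
  have E'_stable: "Int_stable E'"
  proof (rule Int_stableI)
    fix S T assume "S \<in> E'" "T \<in> E'"
    then obtain A B where "S = Z -` A \<inter> space M" "T = Z -` B \<inter> space M" "A \<in> sets borel" "B \<in> sets borel"
      by (auto simp: E'_def)
    then show "S \<inter> T \<in> E'" unfolding E'_def by (intro CollectI exI[of _ "A \<inter> B"]) auto
  qed
  have "indep_set E E'"
  proof (rule indep_setI)
    show "E' \<subseteq> events" by (auto simp: E'_def)
    fix S T assume "S \<in> E" "T \<in> E'"
    then obtain F A B where S: "S = cyl F A" "finite F" "F \<subseteq> I" "\<And>i. A i \<in> sets borel"
      and T: "T = Z -` B \<inter> space M" "B \<in> sets borel"
      by (auto simp: E_def E'_def)
    have "S \<inter> T = {\<omega> \<in> space M. (\<forall>i\<in>F. Y i \<omega> \<in> A i) \<and> Z \<omega> \<in> B}" "T = {\<omega> \<in> space M. Z \<omega> \<in> B}"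
      unfolding S T cyl_def by auto
    then show "prob (S \<inter> T) = prob S * prob T"
      using prob_cylinder_indep[OF Y Z char_mult S(4) T(2) S(2,3)] S(1) by (simp add: cyl_def)
  qed (fact E_sets)
  then have indep: "indep_set (sigma_sets (space M) E) (sigma_sets (space M) E')"
    by (intro indep_set_sigma_sets E_stable E'_stable)
  have space_N: "space N = space M" by (simp add: N_def space_measure_of[OF E_sub])
  have sets_N: "sets N = sigma_sets (space M) E" by (simp add: N_def sets_measure_of[OF E_sub])
  show thesis
  proof (rule that[OF space_N])
    show "Y i \<in> borel_measurable N" if i: "i \<in> I" for i
    proof (rule measurableI)
      fix A :: "real set" assume "A \<in> sets borel"
      then have "cyl {i} (\<lambda>_. A) \<in> E" unfolding E_def using i by blast
      moreover have "Y i -` A \<inter> space N = cyl {i} (\<lambda>_. A)" by (auto simp: cyl_def space_N)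
      ultimately show "Y i -` A \<inter> space N \<in> sets N" by (simp add: sets_N)
    qed simp
    fix H :: "'a \<Rightarrow> real" and A B :: "real set"
    assume H: "H \<in> borel_measurable N" and A: "A \<in> sets borel" and B: "B \<in> sets borel"
    have "H -` A \<inter> space M \<in> sigma_sets (space M) E"
      using measurable_sets[OF H A] by (simp add: space_N sets_N)
    moreover have "Z -` B \<inter> space M \<in> sigma_sets (space M) E'"
      using B by (auto simp: E'_def)
    ultimately have "prob ((H -` A \<inter> space M) \<inter> (Z -` B \<inter> space M))
        = prob (H -` A \<inter> space M) * prob (Z -` B \<inter> space M)"
      by (rule indep_setD[OF indep])
    moreover have "(H -` A \<inter> space M) \<inter> (Z -` B \<inter> space M) = {\<omega> \<in> space M. H \<omega> \<in> A \<and> Z \<omega> \<in> B}"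
      "H -` A \<inter> space M = {\<omega> \<in> space M. H \<omega> \<in> A}" "Z -` B \<inter> space M = {\<omega> \<in> space M. Z \<omega> \<in> B}"
      by auto
    ultimately show "prob {\<omega> \<in> space M. H \<omega> \<in> A \<and> Z \<omega> \<in> B} =
        prob {\<omega> \<in> space M. H \<omega> \<in> A} * prob {\<omega> \<in> space M. Z \<omega> \<in> B}" by (simp only:)
  qed
qed

section \<open>Gaussian processes and white noise\<close>

lemma (in prob_space) centered_gaussian_square_integrable:
  assumes "centered_gaussian M X"
  shows "integrable M (\<lambda>\<omega>. (X \<omega>)\<^sup>2)"
  using assms unfolding centered_gaussian_def
proof (elim conjE disjE exE)
  assume X: "X \<in> borel_measurable M" and 0: "AE \<omega> in M. X \<omega> = 0"
  have "integrable M (\<lambda>\<omega>. (X \<omega>)\<^sup>2) \<longleftrightarrow> integrable M (\<lambda>\<omega>. 0 :: real)"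
    using 0 X by (intro integrable_cong_AE) auto
  then show ?thesis by simp
next
  fix \<sigma> :: real assume \<sigma>: "0 < \<sigma>" and X: "distributed M lborel X (normal_density 0 \<sigma>)"
  have "integrable lborel (\<lambda>x. normal_density 0 \<sigma> x * x\<^sup>2)"
    using integrable_normal_moment[OF \<sigma>, of 0 2] by simp
  then show ?thesis
    using distributed_integrable[OF X, of "\<lambda>x. x\<^sup>2"] by simp
qed

lemma (in prob_space) centered_normal_second_moment:
  assumes \<sigma>: "0 < \<sigma>" and X: "distributed M lborel X (normal_density 0 \<sigma>)"
  shows "(\<integral>\<omega>. (X \<omega>)\<^sup>2 \<partial>M) = \<sigma>\<^sup>2"
  using normal_distributed_variance[OF \<sigma> X] normal_distributed_expectation[OF \<sigma> X] by simp

text \<open>The degenerate case obeys the same formula with second moment 0. Additivity of second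
  moments thus becomes a product of characteristic functions.\<close>

lemma (in prob_space) centered_gaussian_char:
  assumes "centered_gaussian M X"
  shows "(\<integral>\<omega>. iexp (X \<omega>) \<partial>M) = complex_of_real (exp (- (\<integral>\<omega>. (X \<omega>)\<^sup>2 \<partial>M) / 2))"
  using assms unfolding centered_gaussian_def
proof (elim conjE disjE exE)
  assume X[measurable]: "X \<in> borel_measurable M" and 0: "AE \<omega> in M. X \<omega> = 0"
  have "(\<integral>\<omega>. iexp (X \<omega>) \<partial>M) = (\<integral>\<omega>. 1 \<partial>M)"
    using 0 by (intro integral_cong_AE) auto
  moreover have "(\<integral>\<omega>. (X \<omega>)\<^sup>2 \<partial>M) = (\<integral>\<omega>. 0 \<partial>M)"
    using 0 by (intro integral_cong_AE) auto
  ultimately show ?thesis by (simp add: prob_space)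
next
  fix \<sigma> :: real
  assume [measurable]: "X \<in> borel_measurable M"
    and \<sigma>: "0 < \<sigma>" and X: "distributed M lborel X (normal_density 0 \<sigma>)"
  have X': "distributed M lborel (\<lambda>\<omega>. X \<omega> / \<sigma>) std_normal_density"
    using normal_standard_normal_convert[OF \<sigma>, of X 0] X by simp
  have "(\<integral>\<omega>. iexp (X \<omega>) \<partial>M) = (\<integral>\<omega>. iexp (\<sigma> * (X \<omega> / \<sigma>)) \<partial>M)"
    using \<sigma> by simp
  also have "\<dots> = char (distr M lborel (\<lambda>\<omega>. X \<omega> / \<sigma>)) \<sigma>"
    unfolding char_def by (rule integral_distr[symmetric]) auto
  also have "distr M lborel (\<lambda>\<omega>. X \<omega> / \<sigma>) = std_normal_distribution"
    using X' by (simp add: distributed_def)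
  finally show ?thesis
    by (simp add: char_std_normal_distribution centered_normal_second_moment[OF \<sigma> X])
qed

text \<open>A process is tested on sets of indices, while a family \<open>f\<close> may repeat an
  index; coefficients of equal indices are collected first. This avoids having to show that kernels
  at distinct points are distinct functions.\<close>

lemma centered_gaussian_process_sum:
  assumes W: "centered_gaussian_process M I W" and J: "finite J" and f: "\<And>j. j \<in> J \<Longrightarrow> f j \<in> I"
  shows "centered_gaussian M (\<lambda>\<omega>. \<Sum>j\<in>J. a j * W (f j) \<omega>)"
proof -
  have "(\<Sum>j\<in>J. a j * W (f j) \<omega>) = (\<Sum>g\<in>f ` J. (\<Sum>j | j \<in> J \<and> f j = g. a j) * W g \<omega>)" for \<omega>
    by (subst sum.image_gen[OF J, of _ f]) (auto intro!: sum.cong simp: sum_distrib_right)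
  moreover have "centered_gaussian M (\<lambda>\<omega>. \<Sum>g\<in>f ` J. (\<Sum>j | j \<in> J \<and> f j = g. a j) * W g \<omega>)"
  proof -
    have "finite (f ` J) \<and> f ` J \<subseteq> I" using J f by blast
    from W[unfolded centered_gaussian_process_def, rule_format, OF this] show ?thesis .
  qed
  ultimately show ?thesis by simp
qed

lemma integrable_mult_square_integrable:
  fixes f g :: "'a \<Rightarrow> real"
  assumes [measurable]: "f \<in> borel_measurable M" "g \<in> borel_measurable M"
    and i: "integrable M (\<lambda>x. (f x)\<^sup>2)" "integrable M (\<lambda>x. (g x)\<^sup>2)"
  shows "integrable M (\<lambda>x. f x * g x)"
proof (rule Bochner_Integration.integrable_bound[OF Bochner_Integration.integrable_add[OF i]])
  have "norm (f x * g x) \<le> norm ((f x)\<^sup>2 + (g x)\<^sup>2)" for x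
  proof -
    have "2 * (\<bar>f x\<bar> * \<bar>g x\<bar>) \<le> (f x)\<^sup>2 + (g x)\<^sup>2"
      using sum_squares_bound[of "\<bar>f x\<bar>" "\<bar>g x\<bar>"] by simp
    moreover have "0 \<le> \<bar>f x\<bar> * \<bar>g x\<bar>" by simp
    ultimately have "\<bar>f x\<bar> * \<bar>g x\<bar> \<le> (f x)\<^sup>2 + (g x)\<^sup>2" by linarith
    then show ?thesis by (simp add: abs_mult)
  qed
  then show "AE x in M. norm (f x * g x) \<le> norm ((f x)\<^sup>2 + (g x)\<^sup>2)" by simp
qed measurable

text \<open>\<open>c / v\<close> is the regression coefficient: covariance \<open>c\<close> with
  \<open>W g\<close> divided by the variance \<open>v\<close> of \<open>W g\<close>. The residual is
  therefore orthogonal to \<open>W g\<close>, and for jointly Gaussian variables orthogonality makes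
  characteristic functions factor.\<close>

lemma (in prob_space) white_noise_residual_char:
  fixes f :: "'i \<Rightarrow> 'z \<Rightarrow> real" and \<phi> :: "'i \<Rightarrow> 'a \<Rightarrow> real"
  assumes W: "white_noise M N W" and g: "g \<in> L2_functions N"
    and f: "\<And>i. i \<in> I \<Longrightarrow> f i \<in> L2_functions N"
    and \<phi>: "\<And>i. i \<in> I \<Longrightarrow> AE \<omega> in M. \<phi> i \<omega> = W (f i) \<omega>"
    and \<phi>_meas: "\<And>i. i \<in> I \<Longrightarrow> \<phi> i \<in> borel_measurable M"
    and v: "v = (\<integral>z. (g z)\<^sup>2 \<partial>N)" "0 < v" and c: "\<And>i. i \<in> I \<Longrightarrow> (\<integral>z. f i z * g z \<partial>N) = c"
    and J: "finite J" "J \<subseteq> I"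
  shows "(\<integral>\<omega>. iexp ((\<Sum>j\<in>J. s j * (\<phi> j \<omega> - c / v * W g \<omega>)) + t * W g \<omega>) \<partial>M) =
    (\<integral>\<omega>. iexp (\<Sum>j\<in>J. s j * (\<phi> j \<omega> - c / v * W g \<omega>)) \<partial>M) * (\<integral>\<omega>. iexp (t * W g \<omega>) \<partial>M)"
proof -
  have gp: "centered_gaussian_process M (L2_functions N) W"
    and cov: "\<And>f g. f \<in> L2_functions N \<Longrightarrow> g \<in> L2_functions N \<Longrightarrow>
      (\<integral>\<omega>. W f \<omega> * W g \<omega> \<partial>M) = (\<integral>z. f z * g z \<partial>N)"
    using W by (auto simp: white_noise_def)
  have fJ: "f j \<in> L2_functions N" if "j \<in> J" for j using f J that by auto
  have W_gauss: "centered_gaussian M (W f)" if "f \<in> L2_functions N" for f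
    using centered_gaussian_process_sum[OF gp, of "{f}" "\<lambda>f. f" "\<lambda>_. 1"] that by simp
  have W_meas: "W f \<in> borel_measurable M" if "f \<in> L2_functions N" for f
    using W_gauss[OF that] by (simp add: centered_gaussian_def)
  have W_int: "integrable M (\<lambda>\<omega>. W f \<omega> * W h \<omega>)" if "f \<in> L2_functions N" "h \<in> L2_functions N" for f h
    using that by (intro integrable_mult_square_integrable W_meas centered_gaussian_square_integrable W_gauss)
  define Q where "Q r \<omega> = (\<Sum>j\<in>J. s j * W (f j) \<omega>) + r * W g \<omega>" for r \<omega>
  have Q_gauss: "centered_gaussian M (Q r)" for r
  proof -
    \<comment> \<open>The extra index \<open>None\<close> stands for \<open>g\<close>, so
      \<open>g\<close> is adjoined to the family even if it already occurs among the
      \<open>f j\<close>.\<close>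
    have "centered_gaussian M (\<lambda>\<omega>. \<Sum>j\<in>insert None (Some ` J).
        case_option r s j * W (case_option g f j) \<omega>)"
      using J fJ g by (intro centered_gaussian_process_sum[OF gp]) auto
    also have "(\<lambda>\<omega>. \<Sum>j\<in>insert None (Some ` J). case_option r s j * W (case_option g f j) \<omega>) = Q r"
      using J by (auto simp: Q_def fun_eq_iff sum.reindex)
    finally show ?thesis .
  qed
  have Q_meas[measurable]: "Q r \<in> borel_measurable M" for r
    using Q_gauss[of r] by (simp add: centered_gaussian_def)
  have [measurable]: "W g \<in> borel_measurable M" using W_meas g .
  \<comment> \<open>This is the total coefficient of \<open>W g\<close> in the combination of
    residuals, so that combination equals \<open>Q r\<close> almost surely.\<close>
  define r where "r = - (c / v) * (\<Sum>j\<in>J. s j)"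
  have uncorrelated: "(\<integral>\<omega>. Q r \<omega> * W g \<omega> \<partial>M) = 0"
  proof -
    have "(\<integral>\<omega>. Q r \<omega> * W g \<omega> \<partial>M) =
        (\<integral>\<omega>. (\<Sum>j\<in>J. s j * (W (f j) \<omega> * W g \<omega>)) + r * (W g \<omega> * W g \<omega>) \<partial>M)"
      by (simp add: Q_def distrib_right sum_distrib_right mult.assoc)
    also have "\<dots> = (\<Sum>j\<in>J. s j * c) + r * v"
      using W_int[OF fJ g] W_int[OF g g] fJ J
      by (subst Bochner_Integration.integral_add)
         (auto simp: cov g v power2_eq_square c subset_iff intro!: sum.cong)
    also have "\<dots> = 0" using v(2) by (simp add: r_def sum_distrib_right[symmetric])
    finally show ?thesis .
  qed
  \<comment> \<open>Pythagoras: \<open>Q (r + t)\<close> is \<open>Q r\<close> plus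
    \<open>t * W g\<close>, and the cross term vanishes because the two are uncorrelated.\<close>
  have second_moment: "(\<integral>\<omega>. (Q (r + t) \<omega>)\<^sup>2 \<partial>M) = (\<integral>\<omega>. (Q r \<omega>)\<^sup>2 \<partial>M) + (\<integral>\<omega>. (t * W g \<omega>)\<^sup>2 \<partial>M)"
  proof -
    have i1: "integrable M (\<lambda>\<omega>. (Q r \<omega>)\<^sup>2)" by (rule centered_gaussian_square_integrable[OF Q_gauss])
    have i2: "integrable M (\<lambda>\<omega>. (W g \<omega>)\<^sup>2)" by (rule centered_gaussian_square_integrable[OF W_gauss[OF g]])
    then have i2': "integrable M (\<lambda>\<omega>. (t * W g \<omega>)\<^sup>2)" by (simp add: power_mult_distrib)
    have i3: "integrable M (\<lambda>\<omega>. 2 * t * (Q r \<omega> * W g \<omega>))"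
      by (intro integrable_mult_right integrable_mult_square_integrable i1 i2) auto
    have "(\<integral>\<omega>. (Q (r + t) \<omega>)\<^sup>2 \<partial>M) =
        (\<integral>\<omega>. ((Q r \<omega>)\<^sup>2 + (t * W g \<omega>)\<^sup>2) + 2 * t * (Q r \<omega> * W g \<omega>) \<partial>M)"
      by (intro Bochner_Integration.integral_cong refl) (simp add: Q_def power2_eq_square algebra_simps)
    also have "\<dots> = (\<integral>\<omega>. (Q r \<omega>)\<^sup>2 \<partial>M) + (\<integral>\<omega>. (t * W g \<omega>)\<^sup>2 \<partial>M) + 2 * t * (\<integral>\<omega>. Q r \<omega> * W g \<omega> \<partial>M)"
      by (subst Bochner_Integration.integral_add[OF Bochner_Integration.integrable_add[OF i1 i2'] i3],
          subst Bochner_Integration.integral_add[OF i1 i2']) simp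
    finally show ?thesis by (simp add: uncorrelated)
  qed
  have tW: "centered_gaussian M (\<lambda>\<omega>. t * W g \<omega>)"
    using centered_gaussian_process_sum[OF gp, of "{g}" "\<lambda>f. f" "\<lambda>_. t"] g by simp
  have AE_eq: "AE \<omega> in M. (\<Sum>j\<in>J. s j * (\<phi> j \<omega> - c / v * W g \<omega>)) = Q r \<omega>"
  proof -
    have "AE \<omega> in M. \<forall>j\<in>J. \<phi> j \<omega> = W (f j) \<omega>"
      using \<phi> J by (intro AE_finite_allI) auto
    then show ?thesis
      by eventually_elim
         (simp add: Q_def r_def right_diff_distrib sum_subtractf sum_distrib_left sum_distrib_right sum_divide_distrib mult_ac)
  qed
  have [measurable]: "(\<lambda>\<omega>. \<Sum>j\<in>J. s j * (\<phi> j \<omega> - c / v * W g \<omega>)) \<in> borel_measurable M"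
    using J \<phi>_meas by (intro borel_measurable_sum borel_measurable_times borel_measurable_diff) auto
  have "(\<integral>\<omega>. iexp ((\<Sum>j\<in>J. s j * (\<phi> j \<omega> - c / v * W g \<omega>)) + t * W g \<omega>) \<partial>M) = (\<integral>\<omega>. iexp (Q (r + t) \<omega>) \<partial>M)"
  proof (intro integral_cong_AE)
    show "AE \<omega> in M. iexp ((\<Sum>j\<in>J. s j * (\<phi> j \<omega> - c / v * W g \<omega>)) + t * W g \<omega>) = iexp (Q (r + t) \<omega>)"
      using AE_eq
    proof eventually_elim
      case (elim \<omega>)
      have "Q r \<omega> + t * W g \<omega> = Q (r + t) \<omega>" by (simp add: Q_def distrib_right)
      then show ?case by (simp only: elim)
    qed
  qed measurable
  also have "\<dots> = complex_of_real (exp (- (\<integral>\<omega>. (Q r \<omega>)\<^sup>2 \<partial>M) / 2)) *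
      complex_of_real (exp (- (\<integral>\<omega>. (t * W g \<omega>)\<^sup>2 \<partial>M) / 2))"
    by (simp only: centered_gaussian_char[OF Q_gauss] second_moment of_real_mult[symmetric] exp_add[symmetric])
       (simp add: field_simps)
  also have "\<dots> = (\<integral>\<omega>. iexp (Q r \<omega>) \<partial>M) * (\<integral>\<omega>. iexp (t * W g \<omega>) \<partial>M)"
    by (simp only: centered_gaussian_char[OF Q_gauss] centered_gaussian_char[OF tW])
  also have "(\<integral>\<omega>. iexp (Q r \<omega>) \<partial>M) = (\<integral>\<omega>. iexp (\<Sum>j\<in>J. s j * (\<phi> j \<omega> - c / v * W g \<omega>)) \<partial>M)"
  proof (intro integral_cong_AE)
    show "AE \<omega> in M. iexp (Q r \<omega>) = iexp (\<Sum>j\<in>J. s j * (\<phi> j \<omega> - c / v * W g \<omega>))"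
      using AE_eq by eventually_elim (simp only:)
  qed measurable
  finally show ?thesis .
qed

section \<open>The kernel and the test function\<close>

lemma smooth_continuous_on:
  assumes "smooth f"
  shows "continuous_on S f"
proof -
  have "C_k 0 f" using assms unfolding smooth_def ..
  then show ?thesis using continuous_on_subset[of UNIV f S] by simp
qed

lemma bump_functionD:
  assumes "bump_function r\<^sub>0 k"
  shows "smooth k" "0 \<le> k x" "closure {x. k x \<noteq> 0} \<subseteq> ball 0 r\<^sub>0" "(\<integral>x. (k x)\<^sup>2 \<partial>lborel) = 1"
  using assms unfolding bump_function_def by - (elim conjE, (assumption | erule spec))+

lemma bump_function_continuous_on: "bump_function r\<^sub>0 k \<Longrightarrow> continuous_on S k"
  by (rule smooth_continuous_on[OF bump_functionD(1)])

lemma bump_function_eq_0: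
  assumes "bump_function r\<^sub>0 k" "r\<^sub>0 \<le> norm x"
  shows "k x = 0"
proof (rule ccontr)
  assume "k x \<noteq> 0"
  then have "x \<in> closure {x. k x \<noteq> 0}" by (intro subsetD[OF closure_subset]) simp
  then have "x \<in> ball 0 r\<^sub>0" by (rule subsetD[OF bump_functionD(3)[OF assms(1)]])
  then show False using assms(2) by simp
qed

lemma bump_function_bounded:
  assumes "bump_function r\<^sub>0 k"
  obtains b where "0 \<le> b" "\<And>x. \<bar>k x\<bar> \<le> b"
proof -
  have "bounded (k ` cball 0 r\<^sub>0)"
    by (intro compact_imp_bounded compact_continuous_image bump_function_continuous_on[OF assms]) auto
  then obtain b where b: "\<forall>y\<in>k ` cball 0 r\<^sub>0. norm y \<le> b"
    unfolding bounded_iff ..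
  have "\<bar>k x\<bar> \<le> max b 0" for x
  proof (cases "k x = 0")
    case False
    then have "norm x < r\<^sub>0" using bump_function_eq_0[OF assms, of x] not_le by blast
    then have "norm (k x) \<le> b" by (intro bspec[OF b] imageI) simp
    then show ?thesis by simp
  qed simp
  then show thesis by (rule that[rotated]) simp
qed

lemma field_kernel_measurable:
  assumes "bump_function r\<^sub>0 k"
  shows "field_kernel k n x \<in> borel_measurable borel"
proof -
  have [measurable]: "k \<in> borel_measurable borel"
    by (intro borel_measurable_continuous_onI bump_function_continuous_on[OF assms])
  have [measurable]: "fst \<in> borel_measurable (borel :: (plane \<times> real) measure)"
    "snd \<in> borel_measurable (borel :: (plane \<times> real) measure)"
    by (intro borel_measurable_continuous_onI continuous_intros)+
  show ?thesis unfolding field_kernel_def case_prod_beta' by measurable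
qed

lemma field_kernel_support:
  assumes k: "bump_function r\<^sub>0 k" and nz: "field_kernel k n x (y, t) \<noteq> 0"
  shows "norm (y - x) \<le> r\<^sub>0" "t \<in> {2 powr (- real n - 1)..1}"
proof -
  show t: "t \<in> {2 powr (- real n - 1)..1}"
    using nz by (auto simp: field_kernel_def indicator_def split: if_splits)
  then have t0: "0 < t" "t \<le> 1" by (auto intro: less_le_trans[of 0 "2 powr (- real n - 1)"])
  have "k ((y - x) /\<^sub>R t) \<noteq> 0" using nz by (auto simp: field_kernel_def)
  then have "norm ((y - x) /\<^sub>R t) < r\<^sub>0" using bump_function_eq_0[OF k] not_le by blast
  moreover have "norm ((y - x) /\<^sub>R t) = norm (y - x) / t"
    using t0 by (simp only: norm_scaleR) (simp add: divide_inverse mult.commute)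
  ultimately have "norm (y - x) < r\<^sub>0 * t" using t0 by (simp add: pos_divide_less_eq)
  moreover have "0 < r\<^sub>0 * t" using calculation norm_ge_zero[of "y - x"] by linarith
  \<comment> \<open>Times are at most 1, so rescaling only shrinks the support; one radius
    \<open>r\<^sub>0\<close> serves all times and all \<open>n\<close>.\<close>
  then have "r\<^sub>0 * t \<le> r\<^sub>0" using t0 by (simp add: zero_less_mult_iff)
  ultimately show "norm (y - x) \<le> r\<^sub>0" by linarith
qed

text \<open>The cutoff at \<open>2 powr (- real n - 1)\<close> keeps the time away from the
  singularity of \<open>t powr (- 3 / 2)\<close>. The bound \<open>D\<close> depends on
  \<open>n\<close>, which is harmless: it serves only to show integrability of the kernel and of its
  square.\<close>

lemma field_kernel_bounded:
  assumes k: "bump_function r\<^sub>0 k"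
  obtains D where "\<And>z. \<bar>field_kernel k n x z\<bar> \<le> D * indicator (cball x r\<^sub>0 \<times> {0..1}) z"
proof -
  obtain b where b: "0 \<le> b" "\<And>x. \<bar>k x\<bar> \<le> b" using bump_function_bounded[OF k] by blast
  define a :: real where "a = 2 powr (- real n - 1)"
  have a: "0 < a" by (simp add: a_def)
  have "\<bar>field_kernel k n x (y, t)\<bar> \<le> (b * a powr (- 3 / 2)) * indicator (cball x r\<^sub>0 \<times> {0..1}) (y, t)" for y t
  proof (cases "field_kernel k n x (y, t) = 0")
    case False
    note supp = field_kernel_support[OF k False]
    have t: "a \<le> t" "t \<le> 1" using supp(2) by (auto simp: a_def)
    have "(y, t) \<in> cball x r\<^sub>0 \<times> {0..1}" using supp(1) t a by (auto simp: dist_norm norm_minus_commute)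
    moreover have "\<bar>field_kernel k n x (y, t)\<bar> = \<bar>k ((y - x) /\<^sub>R t)\<bar> * t powr (- 3 / 2)"
      using supp(2) by (simp add: field_kernel_def abs_mult)
    moreover have "t powr (- 3 / 2) \<le> a powr (- 3 / 2)"
      using t a by (intro powr_mono2') auto
    then have "\<bar>k ((y - x) /\<^sub>R t)\<bar> * t powr (- 3 / 2) \<le> b * a powr (- 3 / 2)"
      by (intro mult_mono b) auto
    ultimately show ?thesis by simp
  qed (use b in simp)
  then show thesis by (intro that[of "b * a powr (- 3 / 2)"]) (metis surj_pair)
qed

lemma integrable_indicator_slab:
  fixes x :: plane and a b r :: real
  shows "integrable lborel (indicator (cball x r \<times> {a..b}) :: plane \<times> real \<Rightarrow> real)"
proof -
  have "compact (cball x r \<times> {a..b})" by (intro compact_Times) auto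
  then show ?thesis
    by (intro integrable_real_indicator emeasure_bounded_finite compact_imp_bounded)
       (auto dest: compact_imp_closed)
qed

lemma field_kernel_integrable:
  assumes k: "bump_function r\<^sub>0 k"
  shows "integrable lborel (field_kernel k n x)"
proof -
  obtain D where D: "\<And>z. \<bar>field_kernel k n x z\<bar> \<le> D * indicator (cball x r\<^sub>0 \<times> {0..1}) z"
    using field_kernel_bounded[OF k, of n x] by blast
  have "integrable lborel (\<lambda>z. D * indicator (cball x r\<^sub>0 \<times> {0..1::real}) z :: real)"
    by (intro integrable_mult_right integrable_indicator_slab)
  then show ?thesis
  proof (rule Bochner_Integration.integrable_bound)
    show "field_kernel k n x \<in> borel_measurable lborel"
      using field_kernel_measurable[OF k] by simp
    have "norm (field_kernel k n x z) \<le> norm (D * indicator (cball x r\<^sub>0 \<times> {0..1::real}) z :: real)" for z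
      using D[of z] abs_ge_self order_trans unfolding real_norm_def by blast
    then show "AE z in lborel. norm (field_kernel k n x z) \<le> norm (D * indicator (cball x r\<^sub>0 \<times> {0..1::real}) z :: real)"
      by simp
  qed
qed

lemma integrable_space_time:
  assumes "integrable lborel f"
  shows "integrable space_time (f :: plane \<times> real \<Rightarrow> real)"
proof -
  have "closed (UNIV \<times> {0::real..} :: (plane \<times> real) set)" by (intro closed_Times) auto
  then have S: "(UNIV \<times> {0::real..} :: (plane \<times> real) set) \<in> sets lborel" by (simp add: borel_closed)
  show ?thesis unfolding space_time_def
    using integrable_mult_indicator[OF S assms] S by (subst integrable_restrict_space) simp_all
qed

lemma field_kernel_L2:
  assumes k: "bump_function r\<^sub>0 k"
  shows "field_kernel k n x \<in> L2_functions space_time"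
proof -
  obtain D where D: "\<And>z. \<bar>field_kernel k n x z\<bar> \<le> D * indicator (cball x r\<^sub>0 \<times> {0..1}) z"
    using field_kernel_bounded[OF k, of n x] by blast
  have "integrable lborel (\<lambda>z. D\<^sup>2 * indicator (cball x r\<^sub>0 \<times> {0..1::real}) z :: real)"
    by (intro integrable_mult_right integrable_indicator_slab)
  then have "integrable lborel (\<lambda>z. (field_kernel k n x z)\<^sup>2)"
  proof (rule Bochner_Integration.integrable_bound)
    show "(\<lambda>z. (field_kernel k n x z)\<^sup>2) \<in> borel_measurable lborel"
      using field_kernel_measurable[OF k] by simp
    have "(field_kernel k n x z)\<^sup>2 \<le> D\<^sup>2 * indicator (cball x r\<^sub>0 \<times> {0..1::real}) z" for z
      using power_mono[OF D[of z] abs_ge_zero, of 2] by (auto simp: power_mult_distrib indicator_def split: if_splits)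
    then show "AE z in lborel. norm ((field_kernel k n x z)\<^sup>2) \<le> norm (D\<^sup>2 * indicator (cball x r\<^sub>0 \<times> {0..1::real}) z)"
      by (simp add: abs_mult)
  qed
  then show ?thesis
    using field_kernel_measurable[OF k, of n x]
    by (auto simp: L2_functions_def space_time_def intro!: measurable_restrict_space1
        integrable_space_time[unfolded space_time_def])
qed

lemma integral_pos_of_open:
  fixes f :: "'a::euclidean_space \<Rightarrow> real"
  assumes f: "integrable lborel f" and nonneg: "\<And>x. 0 \<le> f x"
    and U: "open U" "U \<noteq> {}" "\<And>x. x \<in> U \<Longrightarrow> 0 < f x"
  shows "0 < (\<integral>x. f x \<partial>lborel)"
proof (rule ccontr)
  assume "\<not> ?thesis"
  moreover have "0 \<le> (\<integral>x. f x \<partial>lborel)" by (simp add: nonneg)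
  ultimately have "(\<integral>x. f x \<partial>lborel) = 0" by simp
  then have "AE x in lborel. f x = 0"
    using integral_nonneg_eq_0_iff_AE[OF f] nonneg by simp
  then have "AE x in lborel. x \<notin> U"
  proof eventually_elim
    case (elim x)
    then show ?case using U(3)[of x] by auto
  qed
  then have "U \<in> null_sets lborel" using U(1) by (simp add: AE_iff_null_sets borel_open)
  then have "negligible U" by (simp add: negligible_iff_null_sets null_sets_completionI)
  then show False using open_not_negligible U(1,2) by blast
qed

text \<open>This integral is the common covariance of the field with the test variable. It is
  positive because \<open>k\<close> is nonnegative and, having square integral 1, nonzero
  somewhere.\<close>

lemma bump_function_test_integral_pos:
  assumes k: "bump_function r\<^sub>0 k"
  shows "0 < (\<integral>z. field_kernel k 0 0 z \<partial>lborel)"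
proof (rule integral_pos_of_open)
  note nonneg = bump_functionD(2)[OF k]
  show "integrable lborel (field_kernel k 0 0)" by (rule field_kernel_integrable[OF k])
  show "0 \<le> field_kernel k 0 0 z" for z
    by (cases z) (auto simp: field_kernel_def nonneg)
  obtain x where x: "k x \<noteq> 0"
  proof (rule ccontr)
    assume "\<not> thesis"
    then have "k x = 0" for x using that by blast
    then show False using bump_functionD(4)[OF k] by simp
  qed
  define T where "T = {z :: plane \<times> real. snd z \<in> {1/2<..<1}}"
  define U where "U = {z \<in> T. (\<lambda>z. k (fst z /\<^sub>R snd z)) z \<in> {0<..}}"
  have "open T" unfolding T_def by (intro open_Collect_conj open_Collect_less continuous_intros | simp)+
  moreover have "continuous_on T (\<lambda>z. k (fst z /\<^sub>R snd z))"
    by (intro continuous_on_compose2[OF bump_function_continuous_on[OF k, of UNIV]] continuous_intros) (auto simp: T_def)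
  ultimately show "open U"
    unfolding U_def using continuous_open_preimage[of T "\<lambda>z. k (fst z /\<^sub>R snd z)" "{0<..}"]
    by (simp add: vimage_def Int_def)
  \<comment> \<open>At height 3/4 this point rescales to \<open>x\<close>, where \<open>k\<close> is
    positive.\<close>
  have "(((3/4) *\<^sub>R x), 3/4) \<in> U" using x nonneg[of x] by (simp add: U_def T_def)
  then show "U \<noteq> {}" by blast
  show "0 < field_kernel k 0 0 z" if "z \<in> U" for z
    using that by (cases z) (auto simp: U_def T_def field_kernel_def powr_minus)
qed

lemma integral_space_time:
  fixes f :: "plane \<times> real \<Rightarrow> real"
  assumes "\<And>y t. t < 0 \<Longrightarrow> f (y, t) = 0"
  shows "(\<integral>z. f z \<partial>space_time) = (\<integral>z. f z \<partial>lborel)"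
proof -
  have "closed (UNIV \<times> {0::real..} :: (plane \<times> real) set)" by (intro closed_Times) auto
  then have "(\<integral>z. f z \<partial>space_time) = (\<integral>z. indicator (UNIV \<times> {0..}) z *\<^sub>R f z \<partial>lborel)"
    unfolding space_time_def by (subst integral_restrict_space) auto
  also have "\<dots> = (\<integral>z. f z \<partial>lborel)"
    using assms by (intro Bochner_Integration.integral_cong refl) (force simp: indicator_def)
  finally show ?thesis .
qed

text \<open>For \<open>n = 0\<close> the time window is exactly \<open>[1/2, 1]\<close>, and it is
  contained in the window of every \<open>n\<close>. The radius \<open>R + r\<^sub>0\<close>
  contains the support about any \<open>x\<close> of norm at most \<open>R\<close>, so the spatial
  cutoff removes nothing. What remains is one fixed function up to translation.\<close>

lemma field_kernel_translate:
  assumes k: "bump_function r\<^sub>0 k" and x: "norm x \<le> R"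
  shows "field_kernel k n x z * indicator (cball 0 (R + r\<^sub>0) \<times> {1/2..1}) z =
    field_kernel k 0 0 ((- x, 0) + z)"
proof (cases z)
  case (Pair y t)
  have le: "2 powr (- real n - 1) \<le> (1 / 2 :: real)"
    using powr_mono[of "- real n - 1" "- 1" "2::real"] by (simp add: powr_minus)
  have half: "2 powr (- 1) = (1 / 2 :: real)" by (simp add: powr_minus)
  show ?thesis
  proof (cases "t \<in> {1/2..1} \<and> k ((y - x) /\<^sub>R t) \<noteq> 0")
    case True
    then have nz: "field_kernel k n x (y, t) \<noteq> 0" using le by (auto simp: field_kernel_def)
    have "norm y \<le> R + r\<^sub>0"
      using field_kernel_support(1)[OF k nz] x norm_triangle_sub[of y x] by linarith
    then show ?thesis using True le half Pair by (auto simp: field_kernel_def)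
  next
    case False
    then show ?thesis using Pair half by (auto simp: field_kernel_def indicator_def)
  qed
qed

lemma field_kernel_test_integral:
  assumes k: "bump_function r\<^sub>0 k" and x: "norm x \<le> R"
  shows "(\<integral>z. field_kernel k n x z * indicator (cball 0 (R + r\<^sub>0) \<times> {1/2..1}) z \<partial>space_time) =
    (\<integral>z. field_kernel k 0 0 z \<partial>lborel)"
proof -
  have "(\<integral>z. field_kernel k n x z * indicator (cball 0 (R + r\<^sub>0) \<times> {1/2..1}) z \<partial>space_time) =
      (\<integral>z. field_kernel k n x z * indicator (cball 0 (R + r\<^sub>0) \<times> {1/2..1}) z \<partial>lborel)"
    by (rule integral_space_time) simp
  also have "\<dots> = (\<integral>z. field_kernel k 0 0 ((- x, 0) + z) \<partial>lborel)"
    by (simp only: field_kernel_translate[OF k x])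
  also have "\<dots> = (\<integral>z. field_kernel k 0 0 z \<partial>distr lborel borel ((+) (- x, 0)))"
    using field_kernel_measurable[OF k] by (subst integral_distr) auto
  finally show ?thesis by (simp only: lborel_distr_plus)
qed

section \<open>Lower bounds for the tails\<close>

text \<open>On an interval of length 1 the minimum of the density bounds the probability from below.
  Bounding \<open>\<bar>x\<bar>\<close> by \<open>w\<close> treats intervals on either side of the
  origin alike.\<close>

lemma (in prob_space) normal_interval_prob_ge:
  assumes \<sigma>: "0 < \<sigma>" and Z: "distributed M lborel Z (normal_density 0 \<sigma>)"
    and w: "\<And>x. x \<in> {l..l + 1} \<Longrightarrow> \<bar>x\<bar> \<le> w"
  shows "normal_density 0 \<sigma> w \<le> prob {\<omega> \<in> space M. Z \<omega> \<in> {l..l + 1}}"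
proof -
  have "ennreal (normal_density 0 \<sigma> w) = (\<integral>\<^sup>+x. ennreal (normal_density 0 \<sigma> w) * indicator {l..l + 1} x \<partial>lborel)"
    by (subst nn_integral_cmult_indicator) auto
  also have "\<dots> \<le> (\<integral>\<^sup>+x. ennreal (normal_density 0 \<sigma> x) * indicator {l..l + 1} x \<partial>lborel)"
  proof (intro nn_integral_mono)
    fix x :: real
    show "ennreal (normal_density 0 \<sigma> w) * indicator {l..l + 1} x \<le> ennreal (normal_density 0 \<sigma> x) * indicator {l..l + 1} x"
    proof (cases "x \<in> {l..l + 1}")
      case True
      then have "x\<^sup>2 \<le> w\<^sup>2" using w[of x] by (intro abs_le_square_iff[THEN iffD1]) auto
      then have "normal_density 0 \<sigma> w \<le> normal_density 0 \<sigma> x"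
        unfolding normal_density_def by (intro mult_left_mono) (auto intro!: divide_right_mono)
      then show ?thesis by (intro mult_right_mono ennreal_leI) auto
    qed simp
  qed
  also have "\<dots> = emeasure M (Z -` {l..l + 1} \<inter> space M)"
    by (rule distributed_emeasure[OF Z, symmetric]) simp
  also have "Z -` {l..l + 1} \<inter> space M = {\<omega> \<in> space M. Z \<omega> \<in> {l..l + 1}}" by auto
  finally show ?thesis by (simp add: emeasure_eq_measure)
qed

lemma gaussian_tail_constants:
  assumes \<sigma>: "0 < (\<sigma> :: real)" and b: "0 < b"
  shows "1 / sqrt (2 * pi * \<sigma>\<^sup>2) * exp (- (R + 1)\<^sup>2 / \<sigma>\<^sup>2) * exp (- (1 / (b * \<sigma>)\<^sup>2) * x\<^sup>2)
    \<le> normal_density 0 \<sigma> (R + x / b + 1)"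
proof -
  \<comment> \<open>The inequality for the square of a sum separates \<open>x\<close> from the
    constants. Its factor 2 cancels the 2 in \<open>2 * \<sigma>\<^sup>2\<close>, which is the
    origin of \<open>1 / (b * \<sigma>)\<^sup>2\<close>.\<close>
  have "(R + x / b + 1)\<^sup>2 \<le> 2 * (R + 1)\<^sup>2 + 2 * (x / b)\<^sup>2"
    using sum_squares_bound[of "R + 1" "x / b"] by (simp add: power2_sum algebra_simps)
  then have "(R + x / b + 1)\<^sup>2 / (2 * \<sigma>\<^sup>2) \<le> (2 * (R + 1)\<^sup>2 + 2 * (x / b)\<^sup>2) / (2 * \<sigma>\<^sup>2)"
    by (intro divide_right_mono) auto
  also have "\<dots> = (R + 1)\<^sup>2 / \<sigma>\<^sup>2 + 1 / (b * \<sigma>)\<^sup>2 * x\<^sup>2"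
    using \<sigma> b by (simp add: field_simps)
  finally have "exp (- (R + 1)\<^sup>2 / \<sigma>\<^sup>2) * exp (- (1 / (b * \<sigma>)\<^sup>2) * x\<^sup>2) \<le> exp (- (R + x / b + 1)\<^sup>2 / (2 * \<sigma>\<^sup>2))"
    by (simp add: exp_add[symmetric])
  then have "1 / sqrt (2 * pi * \<sigma>\<^sup>2) * (exp (- (R + 1)\<^sup>2 / \<sigma>\<^sup>2) * exp (- (1 / (b * \<sigma>)\<^sup>2) * x\<^sup>2))
      \<le> 1 / sqrt (2 * pi * \<sigma>\<^sup>2) * exp (- (R + x / b + 1)\<^sup>2 / (2 * \<sigma>\<^sup>2))"
    by (intro mult_left_mono) auto
  then show ?thesis by (simp add: normal_density_def mult.assoc)
qed

lemma (in prob_space) log_normal_factor_tails: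
  fixes L H Z :: "'a \<Rightarrow> real"
  assumes \<sigma>: "0 < \<sigma>" and Z: "distributed M lborel Z (normal_density 0 \<sigma>)" and b: "0 < b"
    and L_meas[measurable]: "L \<in> borel_measurable M" and H_meas[measurable]: "H \<in> borel_measurable M"
    and H_nonneg: "\<And>\<omega>. 0 \<le> H \<omega>"
    and L_eq: "\<And>\<omega>. \<omega> \<in> space M \<Longrightarrow> L \<omega> = exp (b * Z \<omega>) * H \<omega>"
    and indep: "\<And>A B. A \<in> sets borel \<Longrightarrow> B \<in> sets borel \<Longrightarrow>
      prob {\<omega> \<in> space M. H \<omega> \<in> A \<and> Z \<omega> \<in> B} = prob {\<omega> \<in> space M. H \<omega> \<in> A} * prob {\<omega> \<in> space M. Z \<omega> \<in> B}"
    and med: "is_median M L \<mu>" and x: "0 < x"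
  shows "1 / 4 * normal_density 0 \<sigma> (2 * \<sigma> + x / b + 1) \<le> prob {\<omega> \<in> space M. L \<omega> \<le> \<mu> * exp (- x)}"
    and "1 / 4 * normal_density 0 \<sigma> (2 * \<sigma> + x / b + 1) \<le> prob {\<omega> \<in> space M. \<mu> * exp x \<le> L \<omega>}"
proof -
  have Z_meas[measurable]: "Z \<in> borel_measurable M" using distributed_measurable[OF Z] by simp
  \<comment> \<open>By Chebyshev, two standard deviations leave mass at most 1/4, half of what the
    median guarantees.\<close>
  define R where "R = 2 * \<sigma>"
  \<comment> \<open>In \<open>u\<close>, the part \<open>R\<close> pays for the factor
    \<open>exp (b * R)\<close> lost in passing from \<open>L\<close> to \<open>H\<close>, and
    \<open>x / b\<close> produces the wanted factor \<open>exp x\<close> or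
    \<open>exp (- x)\<close>.\<close>
  define u where "u = R + x / b"
  have u: "0 \<le> u" using \<sigma> b x by (simp add: u_def R_def)
  have bu: "b * u = b * R + x" using b by (simp add: u_def field_simps)
  have H_eq: "H \<omega> = exp (- (b * Z \<omega>)) * L \<omega>" if "\<omega> \<in> space M" for \<omega>
    by (simp add: L_eq[OF that] mult.assoc[symmetric] exp_add[symmetric])
  have L_nonneg: "0 \<le> L \<omega>" if "\<omega> \<in> space M" for \<omega> using H_nonneg by (simp add: L_eq[OF that])
  define S where "S = {\<omega> \<in> space M. R \<le> \<bar>Z \<omega>\<bar>}"
  have [measurable]: "S \<in> sets M" unfolding S_def by measurable
  have "prob S \<le> 1 / 4"
  proof -
    have "integrable lborel (\<lambda>x. normal_density 0 \<sigma> x * x\<^sup>2)"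
      using integrable_normal_moment[OF \<sigma>, of 0 2] by simp
    then have "integrable M (\<lambda>\<omega>. (Z \<omega>)\<^sup>2)" using distributed_integrable[OF Z, of "\<lambda>x. x\<^sup>2"] by simp
    then have "prob {\<omega> \<in> space M. R \<le> \<bar>Z \<omega> - expectation Z\<bar>} \<le> variance Z / R\<^sup>2"
      using \<sigma> by (intro Chebyshev_inequality) (auto simp: R_def)
    then show ?thesis
      using \<sigma> normal_distributed_variance[OF \<sigma> Z] normal_distributed_expectation[OF \<sigma> Z]
      by (simp add: S_def R_def power_mult_distrib)
  qed
  then have quarter: "1 / 4 \<le> prob (T - S)" if "T \<in> sets M" "1 / 2 \<le> prob T" for T
    using finite_measure_Diff'[of T S] finite_measure_mono[of "T \<inter> S" S] that by auto
  \<comment> \<open>The two choices of \<open>l\<close> give \<open>[u, u + 1]\<close> and its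
    mirror image \<open>[- u - 1, - u]\<close>, on both of which the absolute value is at most
    \<open>u + 1\<close>.\<close>
  have tail: "normal_density 0 \<sigma> (u + 1) \<le> prob {\<omega> \<in> space M. Z \<omega> \<in> {l..l + 1}}"
    if "l = u \<or> l = - u - 1" for l
    using that u by (intro normal_interval_prob_ge[OF \<sigma> Z]) auto
  have product: "1 / 4 * normal_density 0 \<sigma> (u + 1) \<le> prob E"
    if l: "l = u \<or> l = - u - 1" and A: "A \<in> sets borel" "1 / 4 \<le> prob {\<omega> \<in> space M. H \<omega> \<in> A}"
      and E: "E \<in> sets M" "{\<omega> \<in> space M. H \<omega> \<in> A \<and> Z \<omega> \<in> {l..l + 1}} \<subseteq> E" for l A E
  proof -
    have "1 / 4 * normal_density 0 \<sigma> (u + 1) \<le>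
        prob {\<omega> \<in> space M. H \<omega> \<in> A} * prob {\<omega> \<in> space M. Z \<omega> \<in> {l..l + 1}}"
      by (intro mult_mono A tail l) (auto simp: normal_density_nonneg)
    also have "\<dots> = prob {\<omega> \<in> space M. H \<omega> \<in> A \<and> Z \<omega> \<in> {l..l + 1}}"
      using indep[OF A(1), of "{l..l + 1}"] by simp
    also have "\<dots> \<le> prob E" using E by (intro finite_measure_mono) auto
    finally show ?thesis .
  qed
  have "1 / 4 * normal_density 0 \<sigma> (u + 1) \<le> prob {\<omega> \<in> space M. L \<omega> \<le> \<mu> * exp (- x)}"
  proof (rule product)
    have "1 / 4 \<le> prob ({\<omega> \<in> space M. L \<omega> \<le> \<mu>} - S)"
      using med by (intro quarter) (auto simp: is_median_def)
    also have "\<dots> \<le> prob {\<omega> \<in> space M. H \<omega> \<in> {..exp (b * R) * \<mu>}}"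
    proof (intro finite_measure_mono subsetI)
      fix \<omega> assume "\<omega> \<in> {\<omega> \<in> space M. L \<omega> \<le> \<mu>} - S"
      then have \<omega>: "\<omega> \<in> space M" "L \<omega> \<le> \<mu>" "- R \<le> Z \<omega>" by (auto simp: S_def)
      have "b * (- R) \<le> b * Z \<omega>" using b \<omega>(3) by (intro mult_left_mono) auto
      then have "exp (- (b * Z \<omega>)) \<le> exp (b * R)" by simp
      then have "H \<omega> \<le> exp (b * R) * \<mu>"
        unfolding H_eq[OF \<omega>(1)] using \<omega>(2) L_nonneg[OF \<omega>(1)] by (intro mult_mono) auto
      then show "\<omega> \<in> {\<omega> \<in> space M. H \<omega> \<in> {..exp (b * R) * \<mu>}}" using \<omega> by simp
    qed measurable
    finally show "1 / 4 \<le> prob {\<omega> \<in> space M. H \<omega> \<in> {..exp (b * R) * \<mu>}}" .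
    show "{\<omega> \<in> space M. H \<omega> \<in> {..exp (b * R) * \<mu>} \<and> Z \<omega> \<in> {- u - 1..- u - 1 + 1}}
        \<subseteq> {\<omega> \<in> space M. L \<omega> \<le> \<mu> * exp (- x)}"
    proof (intro subsetI, elim CollectE conjE)
      fix \<omega> assume \<omega>: "\<omega> \<in> space M" and H: "H \<omega> \<in> {..exp (b * R) * \<mu>}" and Zu: "Z \<omega> \<in> {- u - 1..- u - 1 + 1}"
      have "b * Z \<omega> \<le> b * (- u)" using b Zu by (intro mult_left_mono) auto
      then have "exp (b * Z \<omega>) \<le> exp (- (b * R + x))" using bu by simp
      then have "L \<omega> \<le> exp (- (b * R + x)) * (exp (b * R) * \<mu>)"
        unfolding L_eq[OF \<omega>] using H H_nonneg by (intro mult_mono) auto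
      also have "\<dots> = \<mu> * exp (- x)" by (simp add: mult.assoc[symmetric] exp_add[symmetric] mult.commute)
      finally show "\<omega> \<in> {\<omega> \<in> space M. L \<omega> \<le> \<mu> * exp (- x)}" using \<omega> by simp
    qed
  qed auto
  then show "1 / 4 * normal_density 0 \<sigma> (2 * \<sigma> + x / b + 1) \<le> prob {\<omega> \<in> space M. L \<omega> \<le> \<mu> * exp (- x)}"
    by (simp add: u_def R_def)
  have "1 / 4 * normal_density 0 \<sigma> (u + 1) \<le> prob {\<omega> \<in> space M. \<mu> * exp x \<le> L \<omega>}"
  proof (rule product)
    have "1 / 4 \<le> prob ({\<omega> \<in> space M. \<mu> \<le> L \<omega>} - S)"
      using med by (intro quarter) (auto simp: is_median_def)
    also have "\<dots> \<le> prob {\<omega> \<in> space M. H \<omega> \<in> {exp (- (b * R)) * \<mu>..}}"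
    proof (intro finite_measure_mono subsetI)
      fix \<omega> assume "\<omega> \<in> {\<omega> \<in> space M. \<mu> \<le> L \<omega>} - S"
      then have \<omega>: "\<omega> \<in> space M" "\<mu> \<le> L \<omega>" "Z \<omega> \<le> R" by (auto simp: S_def)
      have "b * Z \<omega> \<le> b * R" using b \<omega>(3) by (intro mult_left_mono) auto
      \<comment> \<open>The exponentials are compared with the nonnegative \<open>L \<omega>\<close>
        as common factor, and \<open>\<mu>\<close> enters only through a positive multiple of
        \<open>\<mu> \<le> L \<omega>\<close>.\<close>
      then have "exp (- (b * R)) * L \<omega> \<le> exp (- (b * Z \<omega>)) * L \<omega>"
        using L_nonneg[OF \<omega>(1)] by (intro mult_right_mono) auto
      moreover have "exp (- (b * R)) * \<mu> \<le> exp (- (b * R)) * L \<omega>"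
        using \<omega>(2) by (intro mult_left_mono) auto
      ultimately have "exp (- (b * R)) * \<mu> \<le> H \<omega>"
        unfolding H_eq[OF \<omega>(1)] by linarith
      then show "\<omega> \<in> {\<omega> \<in> space M. H \<omega> \<in> {exp (- (b * R)) * \<mu>..}}"
        using \<omega>(1) by simp
    qed measurable
    finally show "1 / 4 \<le> prob {\<omega> \<in> space M. H \<omega> \<in> {exp (- (b * R)) * \<mu>..}}" .
    show "{\<omega> \<in> space M. H \<omega> \<in> {exp (- (b * R)) * \<mu>..} \<and> Z \<omega> \<in> {u..u + 1}}
        \<subseteq> {\<omega> \<in> space M. \<mu> * exp x \<le> L \<omega>}"
    proof (intro subsetI, elim CollectE conjE)
      fix \<omega> assume \<omega>: "\<omega> \<in> space M" and H: "H \<omega> \<in> {exp (- (b * R)) * \<mu>..}" and Zu: "Z \<omega> \<in> {u..u + 1}"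
      have "b * u \<le> b * Z \<omega>" using b Zu by (intro mult_left_mono) auto
      then have "exp (b * R + x) * H \<omega> \<le> L \<omega>"
        unfolding L_eq[OF \<omega>] bu[symmetric] using H_nonneg by (intro mult_right_mono) auto
      moreover have "exp (b * R + x) * (exp (- (b * R)) * \<mu>) \<le> exp (b * R + x) * H \<omega>"
        using H by (intro mult_left_mono) auto
      moreover have "exp (b * R + x) * (exp (- (b * R)) * \<mu>) = \<mu> * exp x"
        by (simp add: exp_add exp_minus field_simps)
      ultimately have "\<mu> * exp x \<le> L \<omega>" by linarith
      then show "\<omega> \<in> {\<omega> \<in> space M. \<mu> * exp x \<le> L \<omega>}" using \<omega> by simp
    qed
  qed auto
  then show "1 / 4 * normal_density 0 \<sigma> (2 * \<sigma> + x / b + 1) \<le> prob {\<omega> \<in> space M. \<mu> * exp x \<le> L \<omega>}"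
    by (simp add: u_def R_def)
qed

theorem proposition5p5:
  fixes k :: "plane \<Rightarrow> real" and r\<^sub>0 \<gamma> :: real
  assumes "r\<^sub>0 > 0" and "bump_function r\<^sub>0 k" and "\<gamma> > 0"
  shows "\<exists>c>0. \<exists>C>0.
    \<forall>(M :: 'w measure) W \<phi>.
      prob_space M \<and> white_noise M space_time W \<and> phi_field M k W \<phi> \<longrightarrow>
      (\<forall>n \<mu>. is_median M (\<lambda>\<omega>. lr_length \<gamma> (\<lambda>z. \<phi> n z \<omega>)) \<mu> \<longrightarrow>
        (\<forall>x>0.
          measure M {\<omega> \<in> space M. lr_length \<gamma> (\<lambda>z. \<phi> n z \<omega>) \<le> \<mu> * exp (- x)}
            \<ge> c * exp (- C * x\<^sup>2) \<and>
          measure M {\<omega> \<in> space M. lr_length \<gamma> (\<lambda>z. \<phi> n z \<omega>) \<ge> \<mu> * exp x}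
            \<ge> c * exp (- C * x\<^sup>2)))"
proof -
  note k = assms(2) and \<gamma> = assms(3)
  obtain R where R: "\<And>x. x \<in> cbox 0 (1::plane) \<Longrightarrow> norm x \<le> R"
    using bounded_cbox[of "0::plane" 1] unfolding bounded_iff by blast
  define B where "B = (cball 0 (R + r\<^sub>0) \<times> {1/2..1} :: (plane \<times> real) set)"
  define g :: "plane \<times> real \<Rightarrow> real" where "g = indicator B"
  define m where "m = (\<integral>z. field_kernel k 0 0 z \<partial>lborel)"
  define v where "v = (\<integral>z. (g z)\<^sup>2 \<partial>space_time)"
  have m: "0 < m" unfolding m_def by (rule bump_function_test_integral_pos[OF k])
  have g_sq: "(g z)\<^sup>2 = g z" for z by (simp add: g_def indicator_def)
  have g_int: "integrable lborel g" unfolding g_def B_def by (rule integrable_indicator_slab)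
  have g_L2: "g \<in> L2_functions space_time"
    using integrable_space_time[OF g_int] by (simp add: L2_functions_def g_sq borel_measurable_integrable)
  have R0: "0 \<le> R" using R[of 0] by (simp add: mem_box_cart)
  have v: "0 < v"
  proof -
    have v_eq: "v = (\<integral>z. g z \<partial>lborel)"
      unfolding v_def g_sq by (rule integral_space_time) (simp add: g_def B_def)
    show ?thesis
      unfolding v_eq
    proof (rule integral_pos_of_open[OF g_int])
      show "0 \<le> g z" for z by (simp add: g_def)
      show "open (ball 0 (R + r\<^sub>0) \<times> {1/2<..<1} :: (plane \<times> real) set)" by (intro open_Times) auto
      have "(0, 3/4) \<in> (ball 0 (R + r\<^sub>0) \<times> {1/2<..<1} :: (plane \<times> real) set)" using R0 assms(1) by simp
      then show "ball 0 (R + r\<^sub>0) \<times> {1/2<..<1} \<noteq> ({} :: (plane \<times> real) set)" by blast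
      show "0 < g z" if "z \<in> ball 0 (R + r\<^sub>0) \<times> {1/2<..<1}" for z
        using that by (auto simp: g_def B_def)
    qed
  qed
  define \<sigma> where "\<sigma> = sqrt v"
  have \<sigma>: "0 < \<sigma>" using v by (simp add: \<sigma>_def)
  \<comment> \<open>\<open>m / v\<close> is the coefficient of \<open>Z\<close> in the field, and
    \<open>\<gamma> / 2\<close> comes from the length density
    \<open>exp (\<gamma> / 2 * h)\<close>.\<close>
  define b where "b = \<gamma> / 2 * (m / v)"
  have b: "0 < b" using m v \<gamma> by (simp add: b_def)
  \<comment> \<open>The factor 1/4 is the probability retained for \<open>H\<close>; the rest is the
    part free of \<open>x\<close> in the Gaussian bound with \<open>2 * \<sigma>\<close> as its
    \<open>R\<close>. Everything here is fixed by \<open>k\<close>, \<open>\<gamma>\<close> and the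
    disc before \<open>M\<close> and \<open>n\<close> are introduced.\<close>
  define c where "c = 1 / 4 * (1 / sqrt (2 * pi * \<sigma>\<^sup>2) * exp (- (2 * \<sigma> + 1)\<^sup>2 / \<sigma>\<^sup>2))"
  define C where "C = 1 / (b * \<sigma>)\<^sup>2"
  have c: "0 < c" using \<sigma> by (simp add: c_def)
  have C: "0 < C" using \<sigma> b by (simp add: C_def)
  have tail: "c * exp (- C * x\<^sup>2) \<le> 1 / 4 * normal_density 0 \<sigma> (2 * \<sigma> + x / b + 1)" for x
    using gaussian_tail_constants[OF \<sigma> b, of "2 * \<sigma>" x] by (simp add: c_def C_def mult.assoc)
  show ?thesis
  proof (rule exI[of _ c], rule conjI[OF c], rule exI[of _ C], rule conjI[OF C], intro conjI allI impI; elim conjE)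
    fix M :: "'w measure" and W \<phi> n \<mu> x
    assume "prob_space M" and W: "white_noise M space_time W" and \<phi>: "phi_field M k W \<phi>"
      and med: "is_median M (\<lambda>\<omega>. lr_length \<gamma> (\<lambda>z. \<phi> n z \<omega>)) \<mu>" and x: "0 < (x::real)"
    interpret prob_space M by fact
    define Z where "Z = W g"
    define Y where "Y z \<omega> = \<phi> n z \<omega> - m / v * Z \<omega>" for z \<omega>
    define H where "H \<omega> = lr_length \<gamma> (\<lambda>z. Y z \<omega>)" for \<omega>
    have \<phi>_meas: "\<phi> n z \<in> borel_measurable M"
      and \<phi>_W: "AE \<omega> in M. \<phi> n z \<omega> = W (field_kernel k n z) \<omega>" for z
      using \<phi> by (auto simp: phi_field_def)
    have \<phi>_cont: "continuous_on S (\<lambda>z. \<phi> n z \<omega>)" if "\<omega> \<in> space M" for \<omega> S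
      using \<phi> that by (intro smooth_continuous_on) (auto simp: phi_field_def)
    have Z_gauss: "centered_gaussian M Z"
      using W g_L2 centered_gaussian_process_sum[of M "L2_functions space_time" W "{g}" "\<lambda>f. f" "\<lambda>_. 1"]
      by (simp add: Z_def white_noise_def)
    then have Z_meas: "Z \<in> borel_measurable M" by (simp add: centered_gaussian_def)
    have Z2: "(\<integral>\<omega>. (Z \<omega>)\<^sup>2 \<partial>M) = v"
      using W g_L2 by (simp add: white_noise_def Z_def v_def power2_eq_square)
    \<comment> \<open>The second moment \<open>v\<close> is positive, which excludes the degenerate
      case and forces the standard deviation to be \<open>sqrt v\<close>.\<close>
    have Z_normal: "distributed M lborel Z (normal_density 0 \<sigma>)"
      using Z_gauss unfolding centered_gaussian_def
    proof (elim conjE disjE exE)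
      assume "AE \<omega> in M. Z \<omega> = 0"
      then have "(\<integral>\<omega>. (Z \<omega>)\<^sup>2 \<partial>M) = (\<integral>\<omega>. 0 \<partial>M)"
        using Z_meas by (intro integral_cong_AE) auto
      then show ?thesis using Z2 v by simp
    next
      fix s :: real assume s: "0 < s" "distributed M lborel Z (normal_density 0 s)"
      then have "s = \<sigma>" using centered_normal_second_moment[OF s] Z2 by (simp add: \<sigma>_def)
      then show ?thesis using s by simp
    qed
    have cov: "(\<integral>z. field_kernel k n x z * g z \<partial>space_time) = m" if "x \<in> cbox 0 1" for x
      unfolding g_def B_def m_def by (rule field_kernel_test_integral[OF k R[OF that]])
    obtain N where N: "space N = space M" "\<And>z. z \<in> cbox 0 1 \<Longrightarrow> Y z \<in> borel_measurable N"
      and indep: "\<And>H A B. H \<in> borel_measurable N \<Longrightarrow> A \<in> sets borel \<Longrightarrow> B \<in> sets borel \<Longrightarrow>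
        prob {\<omega> \<in> space M. (H \<omega> :: real) \<in> A \<and> Z \<omega> \<in> B} =
        prob {\<omega> \<in> space M. H \<omega> \<in> A} * prob {\<omega> \<in> space M. Z \<omega> \<in> B}"
    proof (rule indep_sigma_algebra_exists[of "cbox 0 1" Y Z])
      show "Y z \<in> borel_measurable M" for z
        unfolding Y_def[abs_def] using \<phi>_meas Z_meas by measurable
      show "Z \<in> borel_measurable M" by (rule Z_meas)
      show "(\<integral>\<omega>. iexp ((\<Sum>j\<in>J. s j * Y j \<omega>) + t * Z \<omega>) \<partial>M) =
          (\<integral>\<omega>. iexp (\<Sum>j\<in>J. s j * Y j \<omega>) \<partial>M) * (\<integral>\<omega>. iexp (t * Z \<omega>) \<partial>M)"
        if "finite J" "J \<subseteq> cbox 0 1" for J s t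
        unfolding Y_def Z_def
        by (rule white_noise_residual_char[OF W g_L2 field_kernel_L2[OF k] \<phi>_W \<phi>_meas v_def v cov that])
    qed blast
    have Y_cont: "continuous_on S (\<lambda>z. Y z \<omega>)" if "\<omega> \<in> space M" for \<omega> S
      unfolding Y_def by (intro continuous_intros \<phi>_cont that)
    \<comment> \<open>Measurability for \<open>N\<close>, not just for \<open>M\<close>, is what
      turns the independence of the residual values into independence of \<open>H\<close> and
      \<open>Z\<close>.\<close>
    have H_N: "H \<in> borel_measurable N"
      unfolding H_def[abs_def]
      by (rule borel_measurable_lr_length[OF \<gamma>]) (simp_all add: N Y_cont)
    have H_M: "H \<in> borel_measurable M"
      unfolding H_def[abs_def]
    proof (rule borel_measurable_lr_length[OF \<gamma>])
      show "Y z \<in> borel_measurable M" for z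
        unfolding Y_def[abs_def] using \<phi>_meas Z_meas by measurable
    qed (rule Y_cont)
    have L_M: "(\<lambda>\<omega>. lr_length \<gamma> (\<lambda>z. \<phi> n z \<omega>)) \<in> borel_measurable M"
      by (rule borel_measurable_lr_length[OF \<gamma> \<phi>_meas \<phi>_cont])
    have L_eq: "lr_length \<gamma> (\<lambda>z. \<phi> n z \<omega>) = exp (b * Z \<omega>) * H \<omega>" if "\<omega> \<in> space M" for \<omega>
      using lr_length_add_const[OF Y_cont[OF that] \<gamma>, of "m / v * Z \<omega>"]
      by (simp add: H_def Y_def b_def mult.assoc)
    show "c * exp (- C * x\<^sup>2) \<le> measure M {\<omega> \<in> space M. lr_length \<gamma> (\<lambda>z. \<phi> n z \<omega>) \<le> \<mu> * exp (- x)}"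
      by (rule order_trans[OF tail log_normal_factor_tails(1)[OF \<sigma> Z_normal b L_M H_M _ L_eq indep[OF H_N] med x]])
         (simp_all add: H_def lr_length_nonneg)
    show "c * exp (- C * x\<^sup>2) \<le> measure M {\<omega> \<in> space M. \<mu> * exp x \<le> lr_length \<gamma> (\<lambda>z. \<phi> n z \<omega>)}"
      by (rule order_trans[OF tail log_normal_factor_tails(2)[OF \<sigma> Z_normal b L_M H_M _ L_eq indep[OF H_N] med x]])
         (simp_all add: H_def lr_length_nonneg)
  qed
qed

end
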